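(* Let $\Sigma$ be a linearly ordered alphabet and let $L \subseteq \Sigma^*$ be a context-free language whose lexicographic ordering $(L, <_{\mathrm{lex}})$ is scattered. Then the Hausdorff rank $\mathrm{r}(L)$ is strictly less than $\omega^\omega$ (ordinal exponentiation).
   Context: An alphabet is a finite set. If $\Sigma$ is an alphabet equipped with a linear order $<$, define on $\Sigma^*$: $u <_{\mathrm{pr}} v$ iff $v = uw$ for some nonempty $w \in \Sigma^*$; $u <_{\mathrm{s}} v$ iff there are words $w, u', v' \in \Sigma^*$ and letters $a < b$ in $\Sigma$ with $u = wau'$ and $v = wbv'$. The lexicographic order is the linear order $<_{\mathrm{lex}} \,=\, <_{\mathrm{pr}} \cup <_{\mathrm{s}}$. The lexicographic ordering of a language $L \subseteq \Sigma^*$ is $(L, <_{\mathrm{lex}})$. A linear ordering is dense if it has at least two elements and for all $x < y$ in it there is $z$ in it with $x < z < y$. A linear ordering is scattered if no dense ordering embeds (by a strictly order-preserving map) into it. A language is called scattered if its lexicographic ordering is. Hausdorff rank: for each countable ordinal $\alpha$ define the class $H_\alpha$ of countable linear orderings as follows. $H_0$ consists of all finite linear orderings (including the empty one); for $\alpha > 0$, $H_\alpha$ is the least class of linear orderings closed under finite ordered sums which contains all linear orderings isomorphic to an ordered sum $\sum_{i \in \mathbb{Z}} P_i$ where each $P_i$ is in $H_{\beta_i}$ for some $\beta_i < \alpha$. By Hausdorff's theorem a countable linear ordering is scattered iff it belongs to some $H_\alpha$ with $\alpha$ a countable ordinal. The rank $\mathrm{r}(P)$ of a countable scattered linear ordering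 $P$ is the least $\alpha$ with $P \in H_\alpha$. For a scattered language $L$, $\mathrm{r}(L)$ denotes $\mathrm{r}(L, <_{\mathrm{lex}})$. *)

theory Defs
  imports Main "HOL-Library.FuncSet"
begin

unbundle cardinal_syntax


section \<open>Context-free languages\<close>

datatype ('n, 't) symbol = Nt 'n | Tm 't

type_synonym ('n, 't) production = "'n \<times> ('n, 't) symbol list"

definition context_free_grammar ::
  "'n set \<Rightarrow> 't set \<Rightarrow> ('n, 't) production set \<Rightarrow> 'n \<Rightarrow> bool" where
  "context_free_grammar N \<Sigma> P S \<longleftrightarrow>
     finite N \<and> finite \<Sigma> \<and> finite P \<and> S \<in> N \<and>
     P \<subseteq> N \<times> lists (Nt ` N \<union> Tm ` \<Sigma>)"

definition derives1 ::
  "('n, 't) production set \<Rightarrow> ('n, 't) symbol list \<Rightarrow> ('n, 't) symbol list \<Rightarrow> bool" where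
  "derives1 P u v \<longleftrightarrow>
     (\<exists>x A y w. (A, w) \<in> P \<and> u = x @ [Nt A] @ y \<and> v = x @ w @ y)"

definition generated_language :: "('n, 't) production set \<Rightarrow> 'n \<Rightarrow> 't list set" where
  "generated_language P S = {w. (derives1 P)\<^sup>*\<^sup>* [Nt S] (map Tm w)}"

text \<open>A grammar has finitely many nonterminals, so it is no restriction to take them to be
  natural numbers.\<close>

definition context_free :: "'t set \<Rightarrow> 't list set \<Rightarrow> bool" where
  "context_free \<Sigma> L \<longleftrightarrow>
     (\<exists>(N :: nat set) P S. context_free_grammar N \<Sigma> P S \<and> L = generated_language P S)"


section \<open>Linear orderings\<close>

text \<open>A linear ordering is a reflexive relation \<open>r\<close> with \<open>Linear_order r\<close>; its underlying set is
  \<open>Field r\<close>. The library's \<open>lexord\<close> is the union of the strict prefix order and the order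
  by the first differing letter.\<close>

definition lex_ordering :: "'a::linorder list set \<Rightarrow> 'a list rel" where
  "lex_ordering L =
     {(u, v). u \<in> L \<and> v \<in> L \<and> (u = v \<or> (u, v) \<in> lexord {(a, b). a < b})}"

definition dense_ordering :: "'a rel \<Rightarrow> bool" where
  "dense_ordering r \<longleftrightarrow>
     Linear_order r \<and>
     (\<exists>x\<in>Field r. \<exists>y\<in>Field r. x \<noteq> y) \<and>
     (\<forall>x y. (x, y) \<in> r - Id \<longrightarrow> (\<exists>z. (x, z) \<in> r - Id \<and> (z, y) \<in> r - Id))"

definition order_embeds :: "'a rel \<Rightarrow> 'b rel \<Rightarrow> bool" where
  "order_embeds r s \<longleftrightarrow>
     (\<exists>f. f ` Field r \<subseteq> Field s \<and> (\<forall>x y. (x, y) \<in> r - Id \<longrightarrow> (f x, f y) \<in> s - Id))"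

text \<open>An ordering that embeds into \<open>r\<close> is isomorphic to its image, whose elements have the type of
  the elements of \<open>r\<close>; hence it suffices that \<open>d\<close> ranges over orderings on that type.\<close>

definition scattered :: "'a rel \<Rightarrow> bool" where
  "scattered (r :: 'a rel) \<longleftrightarrow> \<not> (\<exists>d :: 'a rel. dense_ordering d \<and> order_embeds d r)"

text \<open>The library's \<open>iso\<close> is defined through initial segments; by \<open>iso_iff2\<close> it is the usual
  notion of isomorphism for arbitrary relations.\<close>

definition order_isomorphic :: "'a rel \<Rightarrow> 'b rel \<Rightarrow> bool" where
  "order_isomorphic r s \<longleftrightarrow> (\<exists>f. iso r s f)"

definition ordered_sum :: "'i rel \<Rightarrow> ('i \<Rightarrow> 'a rel) \<Rightarrow> ('i \<times> 'a) rel" where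
  "ordered_sum I P =
     {((i, x), (j, y)). i \<in> Field I \<and> j \<in> Field I \<and> x \<in> Field (P i) \<and> y \<in> Field (P j) \<and>
        ((i, j) \<in> I - Id \<or> i = j \<and> (x, y) \<in> P i)}"


section \<open>Hausdorff rank\<close>

text \<open>Countable linear orderings are represented, up to isomorphism, by orderings of sets of
  natural numbers, and countable ordinals by well-orders of sets of natural numbers, compared by
  \<open>\<le>o\<close> and \<open><o\<close>; the ordinal zero is the empty relation.\<close>

inductive_set finite_sum_closure :: "nat rel set \<Rightarrow> nat rel set" for G where
  base: "p \<in> G \<Longrightarrow> p \<in> finite_sum_closure G"
| finite_sum: "(\<And>i. i < n \<Longrightarrow> q i \<in> finite_sum_closure G) \<Longrightarrow>
    order_isomorphic p (ordered_sum (natLeq_on n) q) \<Longrightarrow> p \<in> finite_sum_closure G"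

function hausdorff_class :: "nat rel \<Rightarrow> nat rel set" where
  "hausdorff_class \<alpha> =
     (if \<alpha> = {} then {p. Linear_order p \<and> finite (Field p)}
      else finite_sum_closure
        {p. \<exists>q :: int \<Rightarrow> nat rel.
           (\<forall>i. \<exists>\<beta>\<in>{\<beta>. \<beta> <o \<alpha>}. q i \<in> hausdorff_class \<beta>) \<and>
           order_isomorphic p (ordered_sum {(i, j). i \<le> j} q)})"
  by auto
termination
  by (relation ordLess) (auto simp: wf_ordLess)

declare hausdorff_class.simps [simp del]

definition in_hausdorff_class :: "'a rel \<Rightarrow> nat rel \<Rightarrow> bool" where
  "in_hausdorff_class r \<alpha> \<longleftrightarrow> (\<exists>p\<in>hausdorff_class \<alpha>. order_isomorphic r p)"

text \<open>The rank is a well-order representing the least suitable ordinal, which is determined up to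
  isomorphism; it is unspecified if \<open>r\<close> belongs to none of the classes.\<close>

definition hausdorff_rank :: "'a rel \<Rightarrow> nat rel" where
  "hausdorff_rank r =
     (SOME \<alpha>. Well_order \<alpha> \<and> in_hausdorff_class r \<alpha> \<and>
        (\<forall>\<beta>. Well_order \<beta> \<and> in_hausdorff_class r \<beta> \<longrightarrow> \<alpha> \<le>o \<beta>))"


section \<open>Ordinal exponentiation\<close>

text \<open>\<open>ord_exp r s\<close> represents the power with base \<open>r\<close> and exponent \<open>s\<close>: functions from \<open>s\<close> to \<open>r\<close>
  with finite support (all but finitely many values are the least element of \<open>r\<close>), compared at
  the largest argument at which they differ.\<close>

definition finite_support :: "'a rel \<Rightarrow> 'b rel \<Rightarrow> ('b \<Rightarrow> 'a) set" where
  "finite_support r s =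
     {f \<in> Field s \<rightarrow>\<^sub>E Field r. finite {x \<in> Field s. underS r (f x) \<noteq> {}}}"

definition ord_exp :: "'a rel \<Rightarrow> 'b rel \<Rightarrow> ('b \<Rightarrow> 'a) rel" where
  "ord_exp r s =
     {(f, g). f \<in> finite_support r s \<and> g \<in> finite_support r s \<and>
        (f = g \<or>
         (\<exists>x\<in>Field s. (f x, g x) \<in> r - Id \<and> (\<forall>y. (x, y) \<in> s - Id \<longrightarrow> f y = g y)))}"

abbreviation omega :: "nat rel" where
  "omega \<equiv> natLeq"

end

theory Submission
  imports Defs "HOL-Library.Multiset_Order" "HOL-Library.Countable"
begin

text \<open>The order type of a language is controlled by the space of infinite words all of whose prefixes
  are prefixes of words of the language: if its Cantor--Bendixson rank is bounded, cutting the
  language along one infinite word turns it into an \<open>\<omega>\<close>-sum followed by a reversed \<open>\<omega>\<close>-sum of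
  languages of smaller rank, so the Hausdorff rank exceeds the Cantor--Bendixson rank by at most one.
  The latter behaves well under union and concatenation.

  If a nonterminal \<open>X\<close> of a grammar with scattered language derives both \<open>uXp\<close> and \<open>vXq\<close>, then
  \<open>uv = vu\<close>, since otherwise the words obtained by iterating \<open>uv\<close> and \<open>vu\<close> contain a dense
  ordering. Hence all left contexts of \<open>X\<close> in its strong component are prefixes of one infinite
  word, and likewise the words \<open>b\<close> with \<open>X \<Rightarrow>\<^sup>* Xb\<close>. A word of \<open>X\<close> leaving this infinite word after
  \<open>n\<close> letters is a concatenation of boundedly many words of lower nonterminals and of words of the
  latter kind, so passing through a strong component raises a bound \<open>\<omega>\<^sup>k\<close> on the rank to at most
  \<open>\<omega>\<^sup>k\<^sup>+\<^sup>1\<close>.\<close>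

section \<open>Prefixes of infinite words and left quotients of languages\<close>

definition follows :: "'a list \<Rightarrow> (nat \<Rightarrow> 'a) \<Rightarrow> bool" where
  "follows u \<pi> \<longleftrightarrow> (\<forall>i<length u. u ! i = \<pi> i)"

definition residual :: "'a list \<Rightarrow> 'a list set \<Rightarrow> 'a list set" where
  "residual u L = {w. u @ w \<in> L}"

definition concat_lang :: "'a list set \<Rightarrow> 'a list set \<Rightarrow> 'a list set" where
  "concat_lang K L = {u @ v | u v. u \<in> K \<and> v \<in> L}"

definition off :: "(nat \<Rightarrow> 'a) set \<Rightarrow> 'a list \<Rightarrow> bool" where
  "off \<Theta> u \<longleftrightarrow> (\<forall>\<pi>\<in>\<Theta>. \<not> follows u \<pi>)"

lemma follows_append:
  "follows (u @ v) \<pi> \<longleftrightarrow> follows u \<pi> \<and> follows v (\<lambda>i. \<pi> (length u + i))"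
proof
  assume *: "follows (u @ v) \<pi>"
  have "u ! i = \<pi> i" if "i < length u" for i
    using *[unfolded follows_def, rule_format, of i] that by (simp add: nth_append)
  moreover have "v ! i = \<pi> (length u + i)" if "i < length v" for i
    using *[unfolded follows_def, rule_format, of "length u + i"] that by simp
  ultimately show "follows u \<pi> \<and> follows v (\<lambda>i. \<pi> (length u + i))"
    by (auto simp: follows_def)
next
  assume *: "follows u \<pi> \<and> follows v (\<lambda>i. \<pi> (length u + i))"
  show "follows (u @ v) \<pi>"
    unfolding follows_def
  proof (intro allI impI)
    fix i assume "i < length (u @ v)"
    then show "(u @ v) ! i = \<pi> i"
      using * by (cases "i < length u") (auto simp: follows_def nth_append)
  qed
qed

lemma follows_Nil [simp]: "follows [] \<pi>"
  by (simp add: follows_def)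

lemma residual_append: "residual (u @ v) L = residual v (residual u L)"
  by (simp add: residual_def)

lemma residual_empty [simp]: "residual u {} = {}"
  by (simp add: residual_def)

lemma residual_Un: "residual u (K \<union> L) = residual u K \<union> residual u L"
  by (auto simp: residual_def)

lemma residual_mono: "K \<subseteq> L \<Longrightarrow> residual u K \<subseteq> residual u L"
  by (auto simp: residual_def)

section \<open>Cantor--Bendixson rank of a language\<close>

text \<open>Natural number multisets stand for the ordinals below \<open>\<omega>\<^sup>\<omega>\<close>, with multiset union as natural
  sum. The predicate bounds the Cantor--Bendixson rank of the space of infinite words all of
  whose prefixes are prefixes of words in the language.\<close>

inductive cb_rank_le :: "nat multiset \<Rightarrow> 'a list set \<Rightarrow> bool" where
  "finite \<Theta> \<Longrightarrow>
   (\<And>u. off \<Theta> u \<Longrightarrow>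
     residual u L = {} \<or> (\<exists>\<beta>. \<beta> < \<alpha> \<and> cb_rank_le \<beta> (residual u L))) \<Longrightarrow>
   cb_rank_le \<alpha> L"

lemma cb_rank_leE:
  assumes "cb_rank_le \<alpha> L"
  obtains \<Theta> where "finite \<Theta>"
    and "\<forall>u. off \<Theta> u \<longrightarrow>
      residual u L = {} \<or> (\<exists>\<beta>. \<beta> < \<alpha> \<and> cb_rank_le \<beta> (residual u L))"
  using assms
proof (cases rule: cb_rank_le.cases)
  case (1 \<Theta>)
  then show ?thesis
    by (intro that[of \<Theta>]) blast+
qed

lemma cb_rank_le_mono:
  assumes "cb_rank_le \<alpha> L" "\<alpha> \<le> \<beta>"
  shows "cb_rank_le \<beta> L"
proof -
  from assms(1) obtain \<Theta> where "finite \<Theta>"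
    and \<Theta>: "\<forall>u. off \<Theta> u \<longrightarrow>
      residual u L = {} \<or> (\<exists>\<beta>. \<beta> < \<alpha> \<and> cb_rank_le \<beta> (residual u L))"
    by (rule cb_rank_leE)
  then show ?thesis
    using assms(2) by (intro cb_rank_le.intros[of \<Theta>]) (simp, metis less_le_trans)
qed

lemma cb_rank_le_subset:
  assumes "cb_rank_le \<alpha> L" "K \<subseteq> L"
  shows "cb_rank_le \<alpha> K"
  using assms
proof (induction arbitrary: K rule: cb_rank_le.induct)
  case (1 \<Theta> L \<alpha>)
  show ?case
  proof (rule cb_rank_le.intros[OF 1(1)])
    fix u assume "off \<Theta> u"
    with 1(2)[of u] residual_mono[OF 1(3), of u]
    show "residual u K = {} \<or> (\<exists>\<beta>. \<beta> < \<alpha> \<and> cb_rank_le \<beta> (residual u K))"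
      by blast
  qed
qed

lemma cb_rank_le_empty: "cb_rank_le \<alpha> {}"
  by (rule cb_rank_le.intros[of "{}"]) auto

lemma cb_rank_le_residual:
  assumes "cb_rank_le \<alpha> L"
  shows "cb_rank_le \<alpha> (residual v L)"
proof -
  from assms obtain \<Theta> where fin: "finite \<Theta>"
    and \<Theta>: "\<forall>u. off \<Theta> u \<longrightarrow>
      residual u L = {} \<or> (\<exists>\<beta>. \<beta> < \<alpha> \<and> cb_rank_le \<beta> (residual u L))"
    by (rule cb_rank_leE)
  show ?thesis
  proof (rule cb_rank_le.intros)
    \<comment> \<open>The infinite words lose their first \<open>length v\<close> letters. Those
      that do not start with \<open>v\<close> are shifted as well, since extra exceptional words are
      harmless.\<close>
    show "finite ((\<lambda>\<pi> i. \<pi> (length v + i)) ` \<Theta>)"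
      using fin by simp
    fix u assume "off ((\<lambda>\<pi> i. \<pi> (length v + i)) ` \<Theta>) u"
    then have "off \<Theta> (v @ u)"
      by (auto simp: off_def follows_append)
    with \<Theta> have "residual (v @ u) L = {} \<or>
        (\<exists>\<beta>. \<beta> < \<alpha> \<and> cb_rank_le \<beta> (residual (v @ u) L))"
      by blast
    then show "residual u (residual v L) = {} \<or>
        (\<exists>\<beta>. \<beta> < \<alpha> \<and> cb_rank_le \<beta> (residual u (residual v L)))"
      by (simp add: residual_append)
  qed
qed

text \<open>An exceptional set only has to be finite, so the two sets may be joined without raising
  the bound. Off their union, the larger of the two smaller bounds serves both languages, because
  the multiset order is linear.\<close>

lemma cb_rank_le_Un:
  assumes "cb_rank_le \<alpha> K" "cb_rank_le \<alpha> L"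
  shows "cb_rank_le \<alpha> (K \<union> L)"
  using assms
proof (induction \<alpha> arbitrary: K L rule: less_induct)
  case (less \<alpha>)
  from less.prems(1) obtain \<Theta> where fin: "finite \<Theta>"
    and \<Theta>: "\<forall>u. off \<Theta> u \<longrightarrow>
      residual u K = {} \<or> (\<exists>\<beta>. \<beta> < \<alpha> \<and> cb_rank_le \<beta> (residual u K))"
    by (rule cb_rank_leE)
  from less.prems(2) obtain \<Theta>' where fin': "finite \<Theta>'"
    and \<Theta>': "\<forall>u. off \<Theta>' u \<longrightarrow>
      residual u L = {} \<or> (\<exists>\<beta>. \<beta> < \<alpha> \<and> cb_rank_le \<beta> (residual u L))"
    by (rule cb_rank_leE)
  show ?case
  proof (rule cb_rank_le.intros)
    show "finite (\<Theta> \<union> \<Theta>')"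
      using fin fin' by simp
    fix u assume u: "off (\<Theta> \<union> \<Theta>') u"
    have u: "off \<Theta> u" "off \<Theta>' u"
      using u by (auto simp: off_def)
    show "residual u (K \<union> L) = {} \<or> (\<exists>\<beta>. \<beta> < \<alpha> \<and> cb_rank_le \<beta> (residual u (K \<union> L)))"
    proof (cases "residual u K = {} \<or> residual u L = {}")
      case True
      then show ?thesis
        using \<Theta> \<Theta>' u by (auto simp: residual_Un)
    next
      case False
      with \<Theta> \<Theta>' u obtain \<beta> \<beta>' where "\<beta> < \<alpha>" "cb_rank_le \<beta> (residual u K)"
        and "\<beta>' < \<alpha>" "cb_rank_le \<beta>' (residual u L)"
        by blast
      then have "max \<beta> \<beta>' < \<alpha>" "cb_rank_le (max \<beta> \<beta>') (residual u K)"
        "cb_rank_le (max \<beta> \<beta>') (residual u L)"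
        by (simp_all add: cb_rank_le_mono[OF _ max.cobounded1] cb_rank_le_mono[OF _ max.cobounded2])
      then have "cb_rank_le (max \<beta> \<beta>') (residual u (K \<union> L))"
        unfolding residual_Un by (intro less.IH)
      with \<open>max \<beta> \<beta>' < \<alpha>\<close> show ?thesis
        by blast
    qed
  qed
qed

lemma cb_rank_le_UN:
  assumes "finite I" "\<And>i. i \<in> I \<Longrightarrow> cb_rank_le \<alpha> (L i)"
  shows "cb_rank_le \<alpha> (\<Union>i\<in>I. L i)"
  using assms by (induction I rule: finite_induct) (simp_all add: cb_rank_le_empty cb_rank_le_Un)

text \<open>The prefix \<open>u\<close> ends either inside the first factor or inside the second. In
  the second case a suffix of \<open>u\<close> has been read in \<open>L\<close>, and there are only
  finitely many suffixes.\<close>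

lemma residual_concat_lang_subset:
  "residual u (concat_lang K L) \<subseteq>
     concat_lang (residual u K) L \<union> (\<Union>i\<in>{..length u}. residual (drop i u) L)"
proof
  fix w assume "w \<in> residual u (concat_lang K L)"
  then obtain x y where xy: "u @ w = x @ y" "x \<in> K" "y \<in> L"
    by (auto simp: residual_def concat_lang_def)
  from xy(1) consider z where "x = u @ z" "w = z @ y" | z where "u = x @ z" "y = z @ w"
    by (auto simp: append_eq_append_conv2)
  then show "w \<in> concat_lang (residual u K) L \<union> (\<Union>i\<in>{..length u}. residual (drop i u) L)"
  proof cases
    case 1
    then show ?thesis
      using xy by (auto simp: residual_def concat_lang_def)
  next
    case (2 z)
    then have "w \<in> residual (drop (length x) u) L"
      using xy by (simp add: residual_def)
    then show ?thesis
      using 2 by (intro UnI2 UN_I[of "length x"]) auto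
  qed
qed

text \<open>Once \<open>u\<close> has left the exceptional words of \<open>K\<close>, the bound for
  \<open>residual u K\<close> drops, the natural sum drops with it by strict monotonicity, and the
  finitely many residuals of \<open>L\<close> stay bounded by \<beta>. The summand
  \<open>{#0#}\<close> keeps \<beta> strictly below the total even when \<alpha> is empty.\<close>

lemma cb_rank_le_concat_lang:
  assumes "cb_rank_le \<alpha> K" "cb_rank_le \<beta> L"
  shows "cb_rank_le (\<alpha> + \<beta> + {#0#}) (concat_lang K L)"
  using assms
proof (induction \<alpha> arbitrary: K rule: less_induct)
  case (less \<alpha>)
  from less.prems(1) obtain \<Theta> where fin: "finite \<Theta>"
    and \<Theta>: "\<forall>u. off \<Theta> u \<longrightarrow>
      residual u K = {} \<or> (\<exists>\<beta>. \<beta> < \<alpha> \<and> cb_rank_le \<beta> (residual u K))"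
    by (rule cb_rank_leE)
  show ?case
  proof (rule cb_rank_le.intros[OF fin], rule disjI2)
    fix u assume "off \<Theta> u"
    with \<Theta> have "residual u K = {} \<or> (\<exists>\<alpha>'. \<alpha>' < \<alpha> \<and> cb_rank_le \<alpha>' (residual u K))"
      by blast
    then obtain \<gamma> where \<gamma>: "\<gamma> < \<alpha> + \<beta> + {#0#}" "\<beta> \<le> \<gamma>"
      "cb_rank_le \<gamma> (concat_lang (residual u K) L)"
    proof (elim disjE exE conjE)
      assume "residual u K = {}"
      then have "concat_lang (residual u K) L = {}"
        by (simp add: concat_lang_def)
      moreover have "\<beta> < \<alpha> + \<beta> + {#0#}"
        by (rule subset_imp_less_mset)
          (auto simp: subset_mset_def multiset_eq_iff intro!: mset_subset_eqI)
      ultimately show ?thesis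
        using that[of \<beta>] by (simp add: cb_rank_le_empty)
    next
      fix \<alpha>' assume \<alpha>': "\<alpha>' < \<alpha>" "cb_rank_le \<alpha>' (residual u K)"
      show ?thesis
      proof (rule that)
        show "\<alpha>' + \<beta> + {#0#} < \<alpha> + \<beta> + {#0#}"
          using \<alpha>'(1) by (intro add_strict_right_mono)
        show "\<beta> \<le> \<alpha>' + \<beta> + {#0#}"
          by (rule subset_eq_imp_le_multiset) (simp add: mset_subset_eqI)
        show "cb_rank_le (\<alpha>' + \<beta> + {#0#}) (concat_lang (residual u K) L)"
          by (rule less.IH) (use \<alpha>' less.prems in auto)
      qed
    qed
    have "cb_rank_le \<gamma> (\<Union>i\<in>{..length u}. residual (drop i u) L)"
      by (intro cb_rank_le_UN cb_rank_le_residual cb_rank_le_mono[OF less.prems(2) \<gamma>(2)]) simp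
    with \<gamma>(3) have "cb_rank_le \<gamma> (residual u (concat_lang K L))"
      by (rule cb_rank_le_subset[OF cb_rank_le_Un residual_concat_lang_subset])
    with \<gamma>(1) show "\<exists>\<gamma><\<alpha> + \<beta> + {#0#}. cb_rank_le \<gamma> (residual u (concat_lang K L))"
      by blast
  qed
qed

lemma cb_rank_le_follows:
  assumes "\<And>w. w \<in> L \<Longrightarrow> follows w \<pi>"
  shows "cb_rank_le \<alpha> L"
proof (rule cb_rank_le.intros[of "{\<pi>}"], simp, rule disjI1)
  fix u assume "off {\<pi>} u"
  then show "residual u L = {}"
    using assms by (force simp: residual_def off_def follows_append)
qed

lemma cb_rank_le_singleton: "cb_rank_le \<alpha> {w}"
  by (rule cb_rank_le_follows[where \<pi> = "(!) w"]) (simp add: follows_def)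

text \<open>The ordinals represented by multisets over \<open>{..k}\<close> are those below \<open>\<omega>\<^sup>k\<^sup>+\<^sup>1\<close>.\<close>

definition small :: "nat \<Rightarrow> 'a list set \<Rightarrow> bool" where
  "small k L \<longleftrightarrow> (\<exists>\<alpha>. set_mset \<alpha> \<subseteq> {..k} \<and> cb_rank_le \<alpha> L)"

lemma small_mono: "small k L \<Longrightarrow> k \<le> l \<Longrightarrow> small l L"
  unfolding small_def using atMost_subset_iff[of k l] by (metis order_trans)

lemma small_subset: "small k L \<Longrightarrow> K \<subseteq> L \<Longrightarrow> small k K"
  unfolding small_def by (meson cb_rank_le_subset)

lemma small_residual: "small k L \<Longrightarrow> small k (residual u L)"
  unfolding small_def by (meson cb_rank_le_residual)

lemma small_empty: "small k {}"
  unfolding small_def by (rule exI[of _ "{#}"]) (simp add: cb_rank_le_empty)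

lemma small_singleton: "small k {w}"
  unfolding small_def by (rule exI[of _ "{#}"]) (simp add: cb_rank_le_singleton)

lemma small_follows: "(\<And>w. w \<in> L \<Longrightarrow> follows w \<pi>) \<Longrightarrow> small k L"
  unfolding small_def by (rule exI[of _ "{#}"]) (simp, rule cb_rank_le_follows)

lemma small_Un:
  assumes "small k K" "small k L"
  shows "small k (K \<union> L)"
proof -
  obtain \<alpha> \<beta> where *: "set_mset \<alpha> \<subseteq> {..k}" "cb_rank_le \<alpha> K" "set_mset \<beta> \<subseteq> {..k}" "cb_rank_le \<beta> L"
    using assms by (auto simp: small_def)
  then have "cb_rank_le (max \<alpha> \<beta>) (K \<union> L)"
    by (intro cb_rank_le_Un)
      (simp_all add: cb_rank_le_mono[OF _ max.cobounded1] cb_rank_le_mono[OF _ max.cobounded2])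
  with * show ?thesis
    unfolding small_def by (intro exI[of _ "max \<alpha> \<beta>"]) (auto simp: max_def)
qed

lemma small_UN:
  assumes "finite I" "\<And>i. i \<in> I \<Longrightarrow> small k (L i)"
  shows "small k (\<Union>i\<in>I. L i)"
  using assms by (induction I rule: finite_induct) (simp_all add: small_empty small_Un)

lemma small_concat_lang:
  assumes "small k K" "small k L"
  shows "small k (concat_lang K L)"
proof -
  obtain \<alpha> \<beta> where *: "set_mset \<alpha> \<subseteq> {..k}" "cb_rank_le \<alpha> K" "set_mset \<beta> \<subseteq> {..k}" "cb_rank_le \<beta> L"
    using assms by (auto simp: small_def)
  then show ?thesis
    unfolding small_def
    using cb_rank_le_concat_lang[OF *(2,4)] by (intro exI[of _ "\<alpha> + \<beta> + {#0#}"]) auto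
qed

text \<open>Replacing an entry by any number of smaller ones decreases a multiset. In ordinal terms,
  a power of \<omega> exceeds all finite sums of smaller powers.\<close>

lemma less_singleton_mset:
  fixes \<alpha> :: "nat multiset"
  assumes "set_mset \<alpha> \<subseteq> {..k}"
  shows "\<alpha> < {#Suc k#}"
  unfolding less_multiset\<^sub>D\<^sub>M using assms
  by (intro exI[of _ "{#Suc k#}"] exI[of _ \<alpha>]) (auto simp: less_Suc_eq_le)

text \<open>The residuals off \<pi> need not have a common bound below
  \<open>\<omega>\<^sup>k\<^sup>+\<^sup>1\<close>, but this power itself, written
  \<open>{#Suc k#}\<close>, lies above all their bounds.\<close>

lemma small_Suc:
  assumes "\<And>u. \<not> follows u \<pi> \<Longrightarrow> small k (residual u L)"
  shows "small (Suc k) L"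
  unfolding small_def
proof (intro exI conjI)
  show "cb_rank_le {#Suc k#} L"
  proof (rule cb_rank_le.intros[of "{\<pi>}"], simp, rule disjI2)
    fix u assume "off {\<pi>} u"
    with assms show "\<exists>\<beta><{#Suc k#}. cb_rank_le \<beta> (residual u L)"
      unfolding small_def off_def by (metis insertI1 less_singleton_mset)
  qed
qed auto

section \<open>The lexicographic ordering\<close>

abbreviation lex_less :: "'a::linorder list \<Rightarrow> 'a list \<Rightarrow> bool" where
  "lex_less u v \<equiv> (u, v) \<in> lexord {(a, b). a < b}"

lemma lex_less_irrefl: "\<not> lex_less u u"
  by (rule lexord_irreflexive) auto

lemma lex_less_trans: "lex_less u v \<Longrightarrow> lex_less v w \<Longrightarrow> lex_less u w"
  by (rule lexord_trans) (auto simp: trans_def)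

lemma lex_less_asym: "lex_less u v \<Longrightarrow> \<not> lex_less v u"
  using lex_less_trans lex_less_irrefl by blast

lemma lex_less_linear: "lex_less u v \<or> u = v \<or> lex_less v u"
  by (rule lexord_linear) auto

lemma lex_less_cong: "lex_less u v \<Longrightarrow> length u = length v \<Longrightarrow> lex_less (w @ u @ x) (w @ v @ y)"
  by (intro lexord_append_leftI lexord_sufI) auto

lemma Field_lex_ordering [simp]: "Field (lex_ordering L) = L"
  by (auto simp: Field_def lex_ordering_def)

lemma Linear_order_lex_ordering: "Linear_order (lex_ordering L)"
  unfolding linear_order_on_def partial_order_on_def preorder_on_def
proof (intro conjI)
  show "lex_ordering L \<subseteq> Field (lex_ordering L) \<times> Field (lex_ordering L)"
    by (auto simp: lex_ordering_def Field_def)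
  show "Refl (lex_ordering L)"
    unfolding refl_on_def Field_lex_ordering by (auto simp: lex_ordering_def)
  show "trans (lex_ordering L)"
    unfolding trans_def lex_ordering_def by (auto intro: lex_less_trans)
  show "antisym (lex_ordering L)"
    unfolding antisym_def lex_ordering_def using lex_less_trans lex_less_irrefl by blast
  show "Total (lex_ordering L)"
    unfolding total_on_def Field_lex_ordering using lex_less_linear by (auto simp: lex_ordering_def)
qed

lemma lex_ordering_strict_iff:
  "(u, v) \<in> lex_ordering L - Id \<longleftrightarrow> u \<in> L \<and> v \<in> L \<and> lex_less u v"
  using lex_less_irrefl by (auto simp: lex_ordering_def)

section \<open>Scattered languages\<close>

text \<open>The words below are indexed by the dyadic rationals in \<open>(0, 1)\<close>, coded by bit lists.\<close>

lemma not_scattered_if_free: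
  fixes L :: "'a::linorder list set"
  assumes lex: "lex_less a b" "lex_less b c"
    and len: "length a = length b" "length b = length c"
    and L: "\<And>t. x @ concat (map (\<lambda>i. if i then c else a) t) @ b @ rest t \<in> L"
  shows "\<not> scattered (lex_ordering L)"
proof -
  define code where "code t = concat (map (\<lambda>i. if i then c else a) t)" for t
  define f where "f t = x @ code t @ b @ rest t" for t
  have code_append: "code (s @ t) = code s @ code t" for s t
    by (simp add: code_def)
  have ac: "lex_less a c"
    using lex by (rule lex_less_trans)
  have left: "lex_less (f (p @ False # r)) (f p)" for p r
    using lex_less_cong[OF lex(1) len(1), of "x @ code p"]
    by (simp add: f_def code_append code_def)
  have right: "lex_less (f p) (f (p @ True # r))" for p r
    using lex_less_cong[OF lex(2) len(2), of "x @ code p"]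
    by (simp add: f_def code_append code_def)
  have fork: "lex_less (f (p @ False # r)) (f (p @ True # r'))" for p r r'
    using left right by (rule lex_less_trans)
  \<comment> \<open>The common prefix of the two codes is split off. If one code is a proper prefix
    of the other, extending the longer one by the bit that points inwards gives a word in between;
    if the codes fork, their common prefix does.\<close>
  have dense: "\<exists>p. lex_less (f s) (f p) \<and> lex_less (f p) (f t)" if st: "lex_less (f s) (f t)" for s t
  proof -
    obtain p s' t' where s: "s = p @ s'" and t: "t = p @ t'"
      and hd: "s' = [] \<or> t' = [] \<or> hd s' \<noteq> hd t'"
      using longest_common_prefix by blast
    consider "s' = []" "t' = []" | i r where "s' = []" "t' = i # r" | i r where "s' = i # r" "t' = []"
      | i r j r' where "s' = i # r" "t' = j # r'" "i \<noteq> j"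
      using hd by (cases s'; cases t') auto
    then show ?thesis
    proof cases
      case 1
      then show ?thesis
        using st s t lex_less_irrefl by auto
    next
      case (2 i r)
      then have "i"
        using st s t left[of p r] lex_less_asym by (cases i) auto
      then show ?thesis
        using right[of p "r @ [False]"] left[of t "[]"] s t 2
        by (intro exI[of _ "t @ [False]"]) simp
    next
      case (3 i r)
      then have "\<not> i"
        using st s t right[of p r] lex_less_asym by (cases i) auto
      then show ?thesis
        using left[of p "r @ [True]"] right[of s "[]"] s t 3
        by (intro exI[of _ "s @ [True]"]) simp
    next
      case (4 i r j r')
      then have "\<not> i" "j"
        using st s t fork[of p r' r] lex_less_asym by (cases i; cases j; auto)+
      then show ?thesis
        using left[of p r] right[of p r'] s t 4 by (intro exI[of _ p]) simp
    qed
  qed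
  have "range f \<subseteq> L"
    using L by (auto simp: f_def code_def)
  have "dense_ordering (lex_ordering (range f))"
    unfolding dense_ordering_def
  proof (intro conjI)
    show "Linear_order (lex_ordering (range f))"
      by (rule Linear_order_lex_ordering)
    show "\<exists>x\<in>Field (lex_ordering (range f)). \<exists>y\<in>Field (lex_ordering (range f)). x \<noteq> y"
      using right[of "[]" "[]"] lex_less_irrefl by (metis Field_lex_ordering rangeI)
    show "\<forall>x y. (x, y) \<in> lex_ordering (range f) - Id \<longrightarrow>
        (\<exists>z. (x, z) \<in> lex_ordering (range f) - Id \<and> (z, y) \<in> lex_ordering (range f) - Id)"
      unfolding lex_ordering_strict_iff using dense by blast
  qed
  moreover have "order_embeds (lex_ordering (range f)) (lex_ordering L)"
    unfolding order_embeds_def lex_ordering_strict_iff Field_lex_ordering using \<open>range f \<subseteq> L\<close>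
    by (intro exI[of _ id]) auto
  ultimately show ?thesis
    unfolding scattered_def by blast
qed

text \<open>If \<open>u @ v\<close> and \<open>v @ u\<close> differ, they are words
  \<open>y\<close>, \<open>z\<close> of \<open>M\<close> of equal length, one below the other, say
  \<open>y\<close> below \<open>z\<close>. Then \<open>y @ y\<close>, \<open>y @ z\<close>,
  \<open>z @ z\<close> increase and have equal length, and their products stay in \<open>M\<close>,
  so \<open>not_scattered_if_free\<close> applies.\<close>

lemma scattered_imp_commute:
  fixes L :: "'a::linorder list set"
  assumes "scattered (lex_ordering L)"
    and M: "\<And>u v. u \<in> M \<Longrightarrow> v \<in> M \<Longrightarrow> u @ v \<in> M"
    and L: "\<And>w. w \<in> M \<Longrightarrow> \<exists>r. x @ w @ r \<in> L"
    and uv: "u \<in> M" "v \<in> M"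
  shows "u @ v = v @ u"
proof (rule ccontr)
  assume "u @ v \<noteq> v @ u"
  then obtain y z where yz: "lex_less y z" "length y = length z" "y \<in> M" "z \<in> M"
    using lex_less_linear[of "u @ v" "v @ u"] M[OF uv] M[OF uv(2,1)] by auto
  have "concat (map (\<lambda>i. if i then z @ z else y @ y) t) @ y @ z \<in> M" for t
    using M yz by (induction t) simp_all
  then have "\<exists>r. \<forall>t. x @ (concat (map (\<lambda>i. if i then z @ z else y @ y) t) @ y @ z) @ r t \<in> L"
    using L by (intro choice) blast
  then obtain r where r: "\<And>t. x @ concat (map (\<lambda>i. if i then z @ z else y @ y) t) @ (y @ z) @ r t \<in> L"
    by auto
  have "lex_less (y @ y) (y @ z)" "lex_less (y @ z) (z @ z)"
    using lex_less_cong[OF yz(1,2), of y "[]" "[]"] lex_less_cong[OF yz(1,2), of "[]" z z] by auto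
  from not_scattered_if_free[OF this _ _ r] assms(1) yz(2) show False
    by simp
qed

text \<open>A word that commutes with a nonempty word \<open>u\<close> is a prefix of the periodic
  word \<open>uuu...\<close>, as cancelling copies of \<open>u\<close> on the left shows. If
  \<open>M\<close> has no nonempty word, any infinite word does.\<close>

lemma commuting_imp_follows:
  assumes "\<And>u v. u \<in> M \<Longrightarrow> v \<in> M \<Longrightarrow> u @ v = v @ u"
  shows "\<exists>\<pi>. \<forall>u\<in>M. follows u \<pi>"
proof (cases "M \<subseteq> {[]}")
  case True
  then show ?thesis
    by (intro exI[of _ undefined]) auto
next
  case False
  then obtain u where u: "u \<in> M" "u \<noteq> []"
    by auto
  define \<pi> where "\<pi> i = u ! (i mod length u)" for i
  have shift: "(\<lambda>i. \<pi> (length u + i)) = \<pi>"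
    by (rule ext) (simp add: \<pi>_def)
  have follows_u: "follows u \<pi>"
    by (simp add: follows_def \<pi>_def)
  have "follows v \<pi>" if "u @ v = v @ u" for v
    using that
  proof (induction v rule: length_induct)
    case (1 v)
    from 1(2) consider w where "u = v @ w" | w where "v = u @ w"
      by (metis append_eq_append_conv2)
    then show ?case
    proof cases
      case 1
      then show ?thesis
        using follows_u by (simp add: follows_append)
    next
      case (2 w)
      then have "follows w \<pi>"
        using 1 u(2) by auto
      then show ?thesis
        using follows_u shift 2 by (simp add: follows_append)
    qed
  qed
  then show ?thesis
    using assms u(1) by blast
qed

section \<open>Context-free grammars\<close>

text \<open>A big-step form of derivation to a terminal word: it follows the parse tree from left to
  right, so that the yield of each symbol is a visible factor.\<close>

inductive gen :: "('n, 't) production set \<Rightarrow> ('n, 't) symbol list \<Rightarrow> 't list \<Rightarrow> bool" for P where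
  Nil: "gen P [] []"
| Tm: "gen P \<alpha> w \<Longrightarrow> gen P (Tm a # \<alpha>) (a # w)"
| Nt: "(A, \<gamma>) \<in> P \<Longrightarrow> gen P \<gamma> u \<Longrightarrow> gen P \<alpha> v \<Longrightarrow> gen P (Nt A # \<alpha>) (u @ v)"

inductive_cases gen_NilE: "gen P [] w"
inductive_cases gen_TmE: "gen P (Tm a # \<alpha>) w"
inductive_cases gen_NtE: "gen P (Nt A # \<alpha>) w"

lemma gen_appendI: "gen P \<alpha> u \<Longrightarrow> gen P \<beta> v \<Longrightarrow> gen P (\<alpha> @ \<beta>) (u @ v)"
  by (induction rule: gen.induct) (auto intro: gen.intros)

lemma gen_appendE:
  assumes "gen P (\<alpha> @ \<beta>) w"
  obtains u v where "w = u @ v" "gen P \<alpha> u" "gen P \<beta> v"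
  using assms
proof (induction \<alpha> arbitrary: w thesis)
  case Nil
  then show ?case
    by (auto intro: gen.intros)
next
  case (Cons s \<alpha>)
  show ?case
  proof (cases s)
    case (Nt A)
    with Cons.prems(2) obtain \<gamma> x y where "(A, \<gamma>) \<in> P" "gen P \<gamma> x" "gen P (\<alpha> @ \<beta>) y" "w = x @ y"
      by (auto elim: gen_NtE)
    with Cons.IH[of y] Cons.prems(1) Nt show ?thesis
      by (metis append.assoc gen.Nt)
  next
    case (Tm a)
    with Cons.prems(2) obtain y where "gen P (\<alpha> @ \<beta>) y" "w = a # y"
      by (auto elim: gen_TmE)
    with Cons.IH[of y] Cons.prems(1) Tm show ?thesis
      by (metis append_Cons gen.Tm)
  qed
qed

lemma gen_Nt_iff: "gen P [Nt A] w \<longleftrightarrow> (\<exists>\<gamma>. (A, \<gamma>) \<in> P \<and> gen P \<gamma> w)"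
proof
  assume "gen P [Nt A] w"
  then show "\<exists>\<gamma>. (A, \<gamma>) \<in> P \<and> gen P \<gamma> w"
    by (auto elim!: gen_NtE gen_NilE)
next
  assume "\<exists>\<gamma>. (A, \<gamma>) \<in> P \<and> gen P \<gamma> w"
  then show "gen P [Nt A] w"
    using gen.Nt[OF _ _ gen.Nil] by fastforce
qed

lemma derives1_cong: "derives1 P u v \<Longrightarrow> derives1 P (x @ u @ y) (x @ v @ y)"
  unfolding derives1_def by (metis append.assoc)

lemma derives_cong: "(derives1 P)\<^sup>*\<^sup>* u v \<Longrightarrow> (derives1 P)\<^sup>*\<^sup>* (x @ u @ y) (x @ v @ y)"
  by (induction rule: rtranclp_induct) (auto intro: derives1_cong rtranclp.rtrancl_into_rtrancl)

lemma gen_imp_derives: "gen P \<alpha> w \<Longrightarrow> (derives1 P)\<^sup>*\<^sup>* \<alpha> (map Tm w)"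
proof (induction rule: gen.induct)
  case (Tm \<alpha> w a)
  then show ?case
    using derives_cong[of P \<alpha> "map Tm w" "[Tm a]" "[]"] by simp
next
  case (Nt A \<gamma> u \<alpha> v)
  have "derives1 P (Nt A # \<alpha>) (\<gamma> @ \<alpha>)"
    unfolding derives1_def using Nt.hyps(1) by (metis append_Cons append_Nil)
  also have "(derives1 P)\<^sup>*\<^sup>* (\<gamma> @ \<alpha>) (map Tm u @ \<alpha>)"
    using derives_cong[OF Nt.IH(1), of "[]" \<alpha>] by simp
  also have "(derives1 P)\<^sup>*\<^sup>* (map Tm u @ \<alpha>) (map Tm (u @ v))"
    using derives_cong[OF Nt.IH(2), of "map Tm u" "[]"] by simp
  finally show ?case .
qed simp

lemma gen_map_Tm: "gen P (map Tm w) w"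
  by (induction w) (auto intro: gen.intros)

lemma derives_imp_gen:
  assumes "(derives1 P)\<^sup>*\<^sup>* \<alpha> (map Tm w)"
  shows "gen P \<alpha> w"
  using assms
proof (induction rule: converse_rtranclp_induct)
  case base
  show ?case
    by (rule gen_map_Tm)
next
  case (step \<alpha> \<beta>)
  then obtain x A y \<gamma> where *: "(A, \<gamma>) \<in> P" "\<alpha> = x @ [Nt A] @ y" "\<beta> = x @ \<gamma> @ y"
    by (auto simp: derives1_def)
  with step.IH obtain u v z where "w = u @ v @ z" "gen P x u" "gen P \<gamma> v" "gen P y z"
    by (metis gen_appendE)
  with * show ?case
    by (metis gen_Nt_iff gen_appendI)
qed

lemma generated_language_eq: "generated_language P S = {w. gen P [Nt S] w}"
  by (auto simp: generated_language_def intro: derives_imp_gen gen_imp_derives)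

text \<open>Encodes \<open>A \<Rightarrow>\<^sup>* u C v\<close> for terminal words
  \<open>u\<close>, \<open>v\<close> along one branch of a parse tree, with \<open>A\<close> at its
  top and \<open>C\<close> at its bottom. The siblings of the branch generate terminal words, so a
  word of \<open>C\<close> always completes to a word of \<open>A\<close>.\<close>

inductive ctx :: "('n, 't) production set \<Rightarrow> 'n \<Rightarrow> 't list \<Rightarrow> 'n \<Rightarrow> 't list \<Rightarrow> bool" for P where
  refl: "ctx P A [] A []"
| step: "(A, \<alpha> @ Nt B # \<beta>) \<in> P \<Longrightarrow> gen P \<alpha> u \<Longrightarrow> gen P \<beta> v \<Longrightarrow> ctx P B u' C v' \<Longrightarrow>
    ctx P A (u @ u') C (v' @ v)"

lemma ctx_trans: "ctx P A u B v \<Longrightarrow> ctx P B u' C v' \<Longrightarrow> ctx P A (u @ u') C (v' @ v)"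
proof (induction arbitrary: u' v' rule: ctx.induct)
  case (refl A)
  then show ?case by simp
next
  case (step A \<alpha> B \<beta> x y x' C y')
  from ctx.step[OF step.hyps(1-3) step.IH[OF step.prems]] show ?case
    by simp
qed

lemma ctx_single:
  "(A, \<alpha> @ Nt B # \<beta>) \<in> P \<Longrightarrow> gen P \<alpha> u \<Longrightarrow> gen P \<beta> v \<Longrightarrow> ctx P A u B v"
  using ctx.step[OF _ _ _ ctx.refl] by fastforce

lemma ctx_gen: "ctx P A u B v \<Longrightarrow> gen P [Nt B] w \<Longrightarrow> gen P [Nt A] (u @ w @ v)"
proof (induction arbitrary: w rule: ctx.induct)
  case (refl A)
  then show ?case by simp
next
  case (step A \<alpha> B \<beta> u v u' C v')
  from gen_appendI[OF step.hyps(2) gen_appendI[OF step.IH[OF step.prems] step.hyps(3)]]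
  show ?case
    using step.hyps(1) by (auto simp: gen_Nt_iff)
qed

definition reach :: "('n, 't) production set \<Rightarrow> 'n \<Rightarrow> 'n \<Rightarrow> bool" where
  "reach P A B \<longleftrightarrow> (\<exists>u v. ctx P A u B v)"

lemma reach_refl: "reach P A A"
  unfolding reach_def by (blast intro: ctx.refl)

lemma reach_trans: "reach P A B \<Longrightarrow> reach P B C \<Longrightarrow> reach P A C"
  unfolding reach_def by (blast intro: ctx_trans)

lemma finite_reach:
  fixes P :: "('n, 't) production set"
  assumes "finite P"
  shows "finite {B. reach P A B}"
proof (rule finite_subset)
  show "{B. reach P A B} \<subseteq> insert A (\<Union>(X, \<gamma>)\<in>P. {B. Nt B \<in> set \<gamma>})"
  proof
    fix B assume "B \<in> {B. reach P A B}"
    then obtain u v where "ctx P A u B v"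
      by (auto simp: reach_def)
    then show "B \<in> insert A (\<Union>(X, \<gamma>)\<in>P. {B. Nt B \<in> set \<gamma>})"
      by (induction rule: ctx.induct) force+
  qed
  have "finite {B. Nt B \<in> set \<gamma>}" for \<gamma> :: "('n, 't) symbol list"
    using finite_vimageI[of "set \<gamma>" Nt] by (simp add: vimage_def inj_def)
  then show "finite (insert A (\<Union>(X, \<gamma>)\<in>P. {B. Nt B \<in> set \<gamma>}))"
    using assms by auto
qed

lemma gen_reach:
  assumes "(A, \<gamma>) \<in> P" "gen P \<gamma> w" "Nt B \<in> set \<gamma>"
  shows "reach P A B"
proof -
  obtain \<alpha> \<beta> where \<gamma>: "\<gamma> = \<alpha> @ Nt B # \<beta>"
    using assms(3) by (meson split_list)
  then obtain u v where "gen P \<alpha> u" "gen P \<beta> v"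
    using assms(2) by (metis append_Cons append_Nil gen_appendE)
  with assms(1) \<gamma> show ?thesis
    unfolding reach_def by (blast intro: ctx_single)
qed

text \<open>The language of a sentential form is a finite concatenation of letters and languages of
  nonterminals.\<close>

lemma small_gen:
  assumes "\<And>B. Nt B \<in> set \<gamma> \<Longrightarrow> small k {w. gen P [Nt B] w}"
  shows "small k {w. gen P \<gamma> w}"
  using assms
proof (induction \<gamma>)
  case Nil
  have "{w. gen P [] w} = {[]}"
    by (auto intro: gen.Nil elim: gen_NilE)
  then show ?case
    by (simp add: small_singleton)
next
  case (Cons s \<gamma>)
  have "{w. gen P (s # \<gamma>) w} \<subseteq> concat_lang {w. gen P [s] w} {w. gen P \<gamma> w}"
    unfolding concat_lang_def by (auto elim!: gen_appendE[of P "[s]" \<gamma>, simplified])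
  moreover have "small k {w. gen P [s] w}"
  proof (cases s)
    case (Tm a)
    then have "{w. gen P [s] w} \<subseteq> {[a]}"
      by (auto elim!: gen_TmE gen_NilE)
    then show ?thesis
      by (rule small_subset[OF small_singleton])
  qed (use Cons.prems in simp)
  ultimately show ?case
    using Cons by (auto intro: small_subset small_concat_lang)
qed

section \<open>Labels of paths in finite graphs\<close>

text \<open>The label of a path lists the labels of its edges from last to first, as the right contexts
  of a derivation do.\<close>

inductive gpath :: "('v \<Rightarrow> 'l list \<Rightarrow> 'v \<Rightarrow> bool) \<Rightarrow> 'v set \<Rightarrow> 'v \<Rightarrow> 'l list \<Rightarrow> 'v \<Rightarrow> bool"
  for e W where
  refl: "v \<in> W \<Longrightarrow> gpath e W v [] v"
| step: "v \<in> W \<Longrightarrow> e v c v' \<Longrightarrow> gpath e W v' b w \<Longrightarrow> gpath e W v (b @ c) w"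

lemma gpath_mono: "gpath e W v b w \<Longrightarrow> W \<subseteq> W' \<Longrightarrow> gpath e W' v b w"
  by (induction rule: gpath.induct) (auto intro: gpath.intros)

text \<open>Cutting a path at its first visit of its endpoint leaves a loop at the endpoint.\<close>

lemma gpath_decompose:
  assumes "gpath e W v b w"
  shows "v = w \<or> (\<exists>b1 v' c b2. gpath e (W - {w}) v b1 v' \<and> v' \<in> W - {w} \<and> e v' c w \<and>
    gpath e W w b2 w \<and> b = b2 @ c @ b1)"
  using assms
proof (induction rule: gpath.induct)
  case (refl v)
  then show ?case by simp
next
  case (step v c v' b w)
  show ?case
  proof (cases "v = w")
    case False
    then have v: "v \<in> W - {w}"
      using step.hyps by simp
    from step.IH show ?thesis
    proof (elim disjE exE conjE)
      assume "v' = w"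
      then have "gpath e (W - {w}) v [] v \<and> v \<in> W - {w} \<and> e v c w \<and> gpath e W w b w \<and>
          b @ c = b @ c @ []"
        using v step.hyps by (auto intro: gpath.refl)
      then show ?thesis
        by blast
    next
      fix b1 x d b2
      assume *: "gpath e (W - {w}) v' b1 x" "x \<in> W - {w}" "e x d w" "gpath e W w b2 w"
        "b = b2 @ d @ b1"
      have "gpath e (W - {w}) v (b1 @ c) x"
        using v step.hyps(2) *(1) by (rule gpath.step)
      with *(2-) have "gpath e (W - {w}) v (b1 @ c) x \<and> x \<in> W - {w} \<and> e x d w \<and>
          gpath e W w b2 w \<and> b @ c = b2 @ d @ b1 @ c"
        by simp
      then show ?thesis
        by blast
    qed
  qed simp
qed

text \<open>Induction on \<open>W\<close>: a path to \<open>w\<close> splits at its first visit of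
  \<open>w\<close> into a path avoiding \<open>w\<close>, an edge and a loop at \<open>w\<close>.
  The induction hypothesis for \<open>W - {w}\<close> covers the first piece, and the label sets are
  concatenated in reverse order.\<close>

lemma small_gpath:
  assumes "finite W"
    and "\<And>v w. v \<in> W \<Longrightarrow> w \<in> W \<Longrightarrow> small k {c. e v c w}"
    and "\<And>v. v \<in> W \<Longrightarrow> small k {b. gpath e W v b v}"
    and "w \<in> W"
  shows "small k {b. gpath e W v b w}"
  using assms
proof (induction W arbitrary: v w rule: finite_psubset_induct)
  case (psubset W)
  have small: "small k {b. gpath e (W - {w}) v b v'}" if "v' \<in> W - {w}" for v'
  proof (rule psubset.IH)
    show "W - {w} \<subset> W" "v' \<in> W - {w}"
      using psubset.prems(3) that by auto
    show "small k {b. gpath e (W - {w}) x b x}" if "x \<in> W - {w}" for x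
      using that by (intro small_subset[OF psubset.prems(2)[of x]]) (auto intro: gpath_mono)
  qed (use psubset.prems(1) in auto)
  have "{b. gpath e W v b w} \<subseteq> {b. gpath e W w b w} \<union>
      (\<Union>v'\<in>W - {w}. concat_lang {b. gpath e W w b w}
        (concat_lang {c. e v' c w} {b. gpath e (W - {w}) v b v'}))"
  proof
    fix b assume b: "b \<in> {b. gpath e W v b w}"
    then have "gpath e W v b w"
      by simp
    from gpath_decompose[OF this] show "b \<in> {b. gpath e W w b w} \<union>
      (\<Union>v'\<in>W - {w}. concat_lang {b. gpath e W w b w}
        (concat_lang {c. e v' c w} {b. gpath e (W - {w}) v b v'}))"
      using b unfolding concat_lang_def by blast
  qed
  moreover have "small k ({b. gpath e W w b w} \<union>
      (\<Union>v'\<in>W - {w}. concat_lang {b. gpath e W w b w}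
        (concat_lang {c. e v' c w} {b. gpath e (W - {w}) v b v'})))"
    using psubset.prems psubset.hyps small
    by (intro small_Un small_UN small_concat_lang) auto
  ultimately show ?case
    by (rule small_subset[rotated])
qed

section \<open>Derivations inside a set of nonterminals\<close>

text \<open>The edges of the graph are the derivation steps that keep the rightmost nonterminal in \<open>C\<close>;
  a vertex records the current nonterminal and the terminal word produced to the left of it.\<close>

definition spine :: "('n, 't) production set \<Rightarrow> 'n set \<Rightarrow> 'n \<times> 't list \<Rightarrow> 't list \<Rightarrow> 'n \<times> 't list \<Rightarrow> bool"
  where "spine P C v b w \<longleftrightarrow> (\<exists>\<alpha> \<beta> u. (fst v, \<alpha> @ Nt (fst w) # \<beta>) \<in> P \<and> fst w \<in> C \<and>
    (\<forall>B\<in>C. Nt B \<notin> set \<beta>) \<and> gen P \<alpha> u \<and> gen P \<beta> b \<and> snd w = snd v @ u)"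

lemma gpath_spine_ctx:
  "gpath (spine P C) W v b w \<Longrightarrow> \<exists>u. snd w = snd v @ u \<and> ctx P (fst v) u (fst w) b"
proof (induction rule: gpath.induct)
  case (refl v)
  then show ?case
    by (auto intro: ctx.refl)
next
  case (step v c v' b w)
  then obtain \<alpha> \<beta> x u where "(fst v, \<alpha> @ Nt (fst v') # \<beta>) \<in> P" "gen P \<alpha> x" "gen P \<beta> c"
    "snd v' = snd v @ x" "snd w = snd v' @ u" "ctx P (fst v') u (fst w) b"
    by (auto simp: spine_def)
  then show ?case
    by (auto intro: ctx.step)
qed

text \<open>The recorded left word only grows along a path, so every vertex carries a prefix of the
  final one and inherits its length bound and its infinite word.\<close>

lemma gpath_spine_restrict:
  assumes "gpath (spine P C) UNIV v b w" "fst v \<in> C"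
    and "follows (snd w) \<pi>" "length (snd w) \<le> n"
  shows "gpath (spine P C) (C \<times> {a. follows a \<pi> \<and> length a \<le> n}) v b w"
  using assms
proof (induction rule: gpath.induct)
  case (refl v)
  then show ?case
    by (cases v) (auto intro: gpath.refl)
next
  case (step v c v' b w)
  obtain x where x: "snd w = snd v @ x"
    using gpath_spine_ctx[OF gpath.step[OF step.hyps]] by blast
  with step.prems have "v \<in> C \<times> {a. follows a \<pi> \<and> length a \<le> n}"
    by (cases v) (auto simp: follows_append)
  then show ?case
    using step by (auto intro: gpath.step simp: spine_def)
qed

text \<open>The rightmost nonterminal of \<open>C\<close> is followed down the parse tree until a
  right-hand side without nonterminals of \<open>C\<close> is met. An arbitrary \<gamma> around
  \<open>Y\<close> makes the induction on \<open>gen\<close> possible; the arbitrary start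
  \<open>x\<close> allows the branch to be extended at its top, where the left word has become
  \<open>x @ w1\<close>.\<close>

lemma gen_spine_decompose:
  assumes "gen P \<gamma> w" "\<gamma> = \<alpha> @ Nt Y # \<beta>" "Y \<in> C"
  shows "\<exists>w1 w2 w3. w = w1 @ w2 @ w3 \<and> gen P \<alpha> w1 \<and> gen P \<beta> w3 \<and>
    (\<forall>x. \<exists>a Z \<delta> c b. gpath (spine P C) UNIV (Y, x) b (Z, x @ a) \<and> Z \<in> C \<and>
       (Z, \<delta>) \<in> P \<and> (\<forall>B\<in>C. Nt B \<notin> set \<delta>) \<and> gen P \<delta> c \<and> w2 = a @ c @ b)"
  using assms
proof (induction arbitrary: \<alpha> Y \<beta> rule: gen.induct)
  case Nil
  then show ?case by simp
next
  case (Tm \<gamma> w t)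
  then obtain \<alpha>' where \<alpha>: "\<alpha> = Tm t # \<alpha>'" "\<gamma> = \<alpha>' @ Nt Y # \<beta>"
    by (cases \<alpha>) auto
  from Tm.IH[OF \<alpha>(2) Tm.prems(2)] obtain w1 w2 w3 where *: "w = w1 @ w2 @ w3" "gen P \<alpha>' w1"
    and **: "gen P \<beta> w3 \<and> (\<forall>x. \<exists>a Z \<delta> c b. gpath (spine P C) UNIV (Y, x) b (Z, x @ a) \<and> Z \<in> C \<and>
       (Z, \<delta>) \<in> P \<and> (\<forall>B\<in>C. Nt B \<notin> set \<delta>) \<and> gen P \<delta> c \<and> w2 = a @ c @ b)"
    by blast
  have "t # w = (t # w1) @ w2 @ w3" "gen P \<alpha> (t # w1)"
    using * \<alpha> by (auto intro: gen.Tm)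
  with ** show ?case
    by blast
next
  case (Nt A \<delta> u \<gamma> v)
  show ?case
  proof (cases \<alpha>)
    case (Cons s \<alpha>')
    with Nt.prems(1) have \<alpha>: "\<alpha> = Nt A # \<alpha>'" "\<gamma> = \<alpha>' @ Nt Y # \<beta>"
      by auto
    from Nt.IH(2)[OF \<alpha>(2) Nt.prems(2)] obtain w1 w2 w3 where *: "v = w1 @ w2 @ w3" "gen P \<alpha>' w1"
      and **: "gen P \<beta> w3 \<and> (\<forall>x. \<exists>a Z \<delta> c b. gpath (spine P C) UNIV (Y, x) b (Z, x @ a) \<and> Z \<in> C \<and>
         (Z, \<delta>) \<in> P \<and> (\<forall>B\<in>C. Nt B \<notin> set \<delta>) \<and> gen P \<delta> c \<and> w2 = a @ c @ b)"
      by blast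
    have "u @ v = (u @ w1) @ w2 @ w3" "gen P \<alpha> (u @ w1)"
      using * \<alpha> Nt.hyps by (auto intro: gen.Nt)
    with ** show ?thesis
      by blast
  next
    case Nil
    with Nt.prems(1) have [simp]: "Y = A" "\<beta> = \<gamma>"
      by auto
    have "\<exists>a Z \<delta>' c b. gpath (spine P C) UNIV (A, x) b (Z, x @ a) \<and> Z \<in> C \<and>
       (Z, \<delta>') \<in> P \<and> (\<forall>B\<in>C. Nt B \<notin> set \<delta>') \<and> gen P \<delta>' c \<and> u = a @ c @ b" for x
    proof (cases "\<forall>B\<in>C. Nt B \<notin> set \<delta>")
      case True
      have "gpath (spine P C) UNIV (A, x) [] (A, x @ [])"
        by (simp add: gpath.refl)
      then show ?thesis
        using True Nt.hyps Nt.prems(2) \<open>Y = A\<close> by (metis append_Nil append_Nil2)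
    next
      case False
      \<comment> \<open>The last nonterminal from \<open>C\<close> is taken, so that \<delta>2,
        which feeds the right context, has none, as \<open>spine\<close> demands.\<close>
      then obtain \<delta>1 s \<delta>2 where "\<delta> = \<delta>1 @ s # \<delta>2" and s: "\<exists>B\<in>C. s = Nt B"
        and \<delta>2: "\<forall>s\<in>set \<delta>2. \<not> (\<exists>B\<in>C. s = Nt B)"
        using split_list_last_prop[of \<delta> "\<lambda>s. \<exists>B\<in>C. s = Nt B"] by blast
      then obtain B where \<delta>: "\<delta> = \<delta>1 @ Nt B # \<delta>2" and B: "B \<in> C"
        by blast
      from Nt.IH(1)[OF \<delta> B] obtain w1 w2 w3 where w: "u = w1 @ w2 @ w3"
        and gen: "gen P \<delta>1 w1" "gen P \<delta>2 w3"
        and dec: "\<forall>x. \<exists>a Z \<delta> c b. gpath (spine P C) UNIV (B, x) b (Z, x @ a) \<and> Z \<in> C \<and>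
          (Z, \<delta>) \<in> P \<and> (\<forall>B\<in>C. Nt B \<notin> set \<delta>) \<and> gen P \<delta> c \<and> w2 = a @ c @ b"
        by blast
      from dec obtain a Z \<epsilon> c b where *: "gpath (spine P C) UNIV (B, x @ w1) b (Z, (x @ w1) @ a)"
        "Z \<in> C" "(Z, \<epsilon>) \<in> P" "\<forall>B\<in>C. Nt B \<notin> set \<epsilon>" "gen P \<epsilon> c" "w2 = a @ c @ b"
        by blast
      have "spine P C (A, x) w3 (B, x @ w1)"
        unfolding spine_def using \<delta> B \<delta>2 gen Nt.hyps(1) by (intro exI) auto
      from gpath.step[OF _ this *(1)]
      have "gpath (spine P C) UNIV (A, x) (b @ w3) (Z, x @ (w1 @ a))"
        by simp
      moreover have "u = (w1 @ a) @ c @ (b @ w3)"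
        using w *(6) by simp
      ultimately show ?thesis
        using *(2-5) by blast
    qed
    then show ?thesis
      using Nt.hyps Nil gen.Nil by (intro exI[of _ "[]"] exI[of _ u] exI[of _ v]) simp
  qed
qed

section \<open>Scattered context-free languages\<close>

lemma finite_length_follows: "finite {a. follows a \<pi> \<and> length a \<le> n}"
proof (rule finite_subset)
  show "{a. follows a \<pi> \<and> length a \<le> n} \<subseteq> (\<lambda>m. map \<pi> [0..<m]) ` {..n}"
  proof clarify
    fix a assume a: "follows a \<pi>" "length a \<le> n"
    have "a = map \<pi> [0..<length a]"
      using a(1) by (intro nth_equalityI) (simp_all add: follows_def)
    then show "a \<in> (\<lambda>m. map \<pi> [0..<m]) ` {..n}"
      using a(2) by blast
  qed
qed simp

text \<open>The words \<open>u\<close> with \<open>X \<Rightarrow>\<^sup>* u X b\<close> are closed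
  under concatenation and occur after \<open>x\<close> in words of the language, so they commute and
  follow one infinite word; a left context leading to some \<open>Y\<close> that reaches
  \<open>X\<close> is a prefix of such a \<open>u\<close>. For empty left contexts the same argument
  applies to the right contexts \<open>b\<close>, which occur right after
  \<open>x @ z\<close>.\<close>

lemma scattered_ctx_follows:
  fixes P :: "('n, 't::linorder) production set"
  assumes scattered: "scattered (lex_ordering {w. gen P [Nt S] w})"
    and S: "ctx P S x X y" and z: "gen P [Nt X] z"
  shows "\<exists>\<pi>. \<forall>a Y b. ctx P X a Y b \<longrightarrow> reach P Y X \<longrightarrow> follows a \<pi>"
    and "\<exists>\<pi>. \<forall>b. ctx P X [] X b \<longrightarrow> follows b \<pi>"
proof -
  have "u @ v = v @ u" if "u \<in> {u. \<exists>b. ctx P X u X b}" "v \<in> {u. \<exists>b. ctx P X u X b}" for u v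
    by (rule scattered_imp_commute[OF scattered, where M = "{u. \<exists>b. ctx P X u X b}" and x = x])
      (use that ctx_trans ctx_gen[OF S] ctx_gen[OF _ z] in fastforce)+
  from commuting_imp_follows[OF this]
  obtain \<pi> where \<pi>: "\<forall>u\<in>{u. \<exists>b. ctx P X u X b}. follows u \<pi>"
    by blast
  have "follows a \<pi>" if aY: "ctx P X a Y b" and Y: "reach P Y X" for a Y b
  proof -
    obtain c d where "ctx P Y c X d"
      using Y by (auto simp: reach_def)
    then have "follows (a @ c) \<pi>"
      using ctx_trans[OF aY] \<pi> by blast
    then show ?thesis
      by (simp add: follows_append)
  qed
  then show "\<exists>\<pi>. \<forall>a Y b. ctx P X a Y b \<longrightarrow> reach P Y X \<longrightarrow> follows a \<pi>"
    by blast
  have "u @ v = v @ u" if "u \<in> {b. ctx P X [] X b}" "v \<in> {b. ctx P X [] X b}" for u v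
  proof (rule scattered_imp_commute[OF scattered, where M = "{b. ctx P X [] X b}" and x = "x @ z"])
    show "\<exists>r. (x @ z) @ w @ r \<in> {w. gen P [Nt S] w}" if "w \<in> {b. ctx P X [] X b}" for w
      using ctx_gen[OF S ctx_gen[OF _ z]] that by fastforce
  qed (use that ctx_trans[of P X "[]" X _ "[]"] in auto)
  then show "\<exists>\<pi>. \<forall>b. ctx P X [] X b \<longrightarrow> follows b \<pi>"
    using commuting_imp_follows[of "{b. ctx P X [] X b}"] by simp
qed

text \<open>Induction on the number of nonterminals reachable from \<open>X\<close>. Those in
  \<open>D\<close> lie strictly below \<open>X\<close> and get a common bound \<open>k\<close>;
  \<open>C\<close> is the strong component of \<open>X\<close>. All left contexts inside
  \<open>C\<close> follow one infinite word \<pi>, and residuals off \<pi> are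
  \<open>small k\<close>, so \<open>small_Suc\<close> yields \<open>Suc k\<close>.\<close>

lemma small_if_scattered:
  fixes P :: "('n, 't::linorder) production set"
  assumes fin: "finite P" and scattered: "scattered (lex_ordering {w. gen P [Nt S] w})"
    and "reach P S X"
  shows "\<exists>k. small k {w. gen P [Nt X] w}"
  using assms(3)
proof (induction "card {B. reach P X B}" arbitrary: X rule: less_induct)
  case less
  define C where "C = {Y. reach P X Y \<and> reach P Y X}"
  define D where "D = {Y. reach P X Y \<and> \<not> reach P Y X}"
  have finCD: "finite C" "finite D"
    unfolding C_def D_def using finite_reach[OF fin, of X] by auto
  have "\<exists>k. small k {w. gen P [Nt Y] w}" if "Y \<in> D" for Y
  proof (rule less.hyps)
    have "{B. reach P Y B} \<subset> {B. reach P X B}"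
      using that reach_refl[of P X] by (auto simp: D_def intro: reach_trans)
    then show "card {B. reach P Y B} < card {B. reach P X B}"
      by (intro psubset_card_mono finite_reach fin)
    show "reach P S Y"
      using less.prems that by (auto simp: D_def intro: reach_trans)
  qed
  then obtain f where f: "\<And>Y. Y \<in> D \<Longrightarrow> small (f Y) {w. gen P [Nt Y] w}"
    by metis
  \<comment> \<open>The \<open>0\<close> covers an empty \<open>D\<close>.\<close>
  define k where "k = Max (insert 0 (f ` D))"
  have k: "small k {w. gen P [Nt Y] w}" if "Y \<in> D" for Y
    using finCD that by (intro small_mono[OF f]) (auto simp: k_def)
  \<comment> \<open>A nonterminal in \<beta> counts as reachable only if its siblings are
    productive. For \<alpha> this is assumed, and an unproductive \<beta> generates the empty
    language.\<close>
  have small_rhs: "small k {w. gen P \<beta> w}"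
    if "(Y, \<alpha> @ \<beta>) \<in> P" "gen P \<alpha> u" "Y \<in> C" "\<forall>B\<in>C. Nt B \<notin> set \<beta>" for Y \<alpha> \<beta> u
  proof (cases "\<exists>w. gen P \<beta> w")
    case True
    show ?thesis
    proof (rule small_gen, rule k)
      fix B assume B: "Nt B \<in> set \<beta>"
      have "reach P Y B"
        using True B that by (auto intro: gen_reach gen_appendI)
      then have "reach P X B"
        using that(3) by (auto simp: C_def intro: reach_trans)
      with that(4) B show "B \<in> D"
        unfolding C_def D_def by blast
    qed
  qed (simp add: small_empty)
  show ?case
  proof (cases "\<exists>z. gen P [Nt X] z")
    case True
    then obtain z where z: "gen P [Nt X] z"
      by blast
    obtain x y where S: "ctx P S x X y"
      using less.prems by (auto simp: reach_def)
    from scattered_ctx_follows(1)[OF scattered S z] obtain \<pi>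
      where \<pi>: "\<And>a Y b. ctx P X a Y b \<Longrightarrow> Y \<in> C \<Longrightarrow> follows a \<pi>"
      unfolding C_def by blast
    have loops: "\<exists>\<pi>. \<forall>b. ctx P Y [] Y b \<longrightarrow> follows b \<pi>" if Y: "Y \<in> C" for Y
    proof -
      obtain u v u' v' where "ctx P X u Y v" "ctx P Y u' X v'"
        using Y by (auto simp: C_def reach_def)
      then show ?thesis
        using scattered_ctx_follows(2)[OF scattered ctx_trans[OF S] ctx_gen[OF _ z]] by blast
    qed
    have "small k (residual u {w. gen P [Nt X] w})" if u: "\<not> follows u \<pi>" for u
    proof -
      \<comment> \<open>For words beginning with \<open>u\<close> these vertices suffice: a left
        word longer than \<open>u\<close> would begin with \<open>u\<close> and thus leave \<pi>.
        They are finitely many, since \<pi> has one prefix of each length.\<close>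
      define W where "W = C \<times> {a. follows a \<pi> \<and> length a \<le> length u}"
      have finW: "finite W"
        unfolding W_def using finCD finite_length_follows by blast
      define leave where "leave Y = (\<Union>(Z, \<delta>)\<in>{(Z, \<delta>)\<in>P. Z = Y \<and> (\<forall>B\<in>C. Nt B \<notin> set \<delta>)}. {w. gen P \<delta> w})"
        for Y
      have small_leave: "small k (leave Y)" if "Y \<in> C" for Y
        unfolding leave_def
      proof (rule small_UN)
        show "finite {(Z, \<delta>) \<in> P. Z = Y \<and> (\<forall>B\<in>C. Nt B \<notin> set \<delta>)}"
          by (rule finite_subset[OF _ fin]) auto
      qed (use that small_rhs[of _ "[]", OF _ gen.Nil] in auto)
      have small_edge: "small k {b. spine P C v b w}" if "v \<in> W" "w \<in> W" for v w
      proof -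
        \<comment> \<open>\<open>T\<close> lists all ways to cut a right-hand side around one
          symbol, \<open>T'\<close> those that can realise an edge from \<open>v\<close> to
          \<open>w\<close>.\<close>
        define T where "T = (\<Union>(Y, \<gamma>)\<in>P. \<Union>i\<le>length \<gamma>. {(Y, take i \<gamma>, drop (Suc i) \<gamma>)})"
        define T' where "T' = {(Y, \<alpha>, \<beta>)\<in>T. Y = fst v \<and> (Y, \<alpha> @ Nt (fst w) # \<beta>) \<in> P \<and>
          (\<forall>B\<in>C. Nt B \<notin> set \<beta>) \<and> (\<exists>u. gen P \<alpha> u)}"
        have "finite T"
          unfolding T_def using fin by auto
        then have "finite T'"
          by (rule rev_finite_subset) (auto simp: T'_def)
        have sub: "{b. spine P C v b w} \<subseteq> (\<Union>(Y, \<alpha>, \<beta>)\<in>T'. {b. gen P \<beta> b})"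
        proof
          fix b assume "b \<in> {b. spine P C v b w}"
          then obtain \<alpha> \<beta> x where *: "(fst v, \<alpha> @ Nt (fst w) # \<beta>) \<in> P" "\<forall>B\<in>C. Nt B \<notin> set \<beta>"
            "gen P \<alpha> x" "gen P \<beta> b"
            by (auto simp: spine_def)
          have "(fst v, \<alpha>, \<beta>) \<in> T"
            unfolding T_def
            by (rule UN_I[OF *(1)], simp only: prod.case, rule UN_I[of "length \<alpha>"]) simp_all
          with * have "(fst v, \<alpha>, \<beta>) \<in> T'"
            unfolding T'_def by auto
          with *(4) show "b \<in> (\<Union>(Y, \<alpha>, \<beta>)\<in>T'. {b. gen P \<beta> b})"
            by blast
        qed
        have "small k {b. gen P \<beta> b}" if T': "(Y, \<alpha>, \<beta>) \<in> T'" for Y \<alpha> \<beta>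
        proof -
          from T' \<open>w \<in> W\<close> \<open>v \<in> W\<close> obtain x where *: "(Y, \<alpha> @ Nt (fst w) # \<beta>) \<in> P" "gen P \<alpha> x"
            "\<forall>B\<in>C. Nt B \<notin> set \<beta>" "Y \<in> C" "fst w \<in> C"
            unfolding T'_def W_def by auto
          \<comment> \<open>\<open>fst w\<close> is productive because it reaches \<open>X\<close>;
            hence it may join the left part in \<open>small_rhs\<close>.\<close>
          then obtain t where t: "gen P [Nt (fst w)] t"
            unfolding C_def reach_def using ctx_gen[OF _ z] by blast
          show ?thesis
            using small_rhs[of Y "\<alpha> @ [Nt (fst w)]" \<beta>, OF _ gen_appendI[OF *(2) t]] * by simp
        qed
        then have "small k (case t of (Y, \<alpha>, \<beta>) \<Rightarrow> {b. gen P \<beta> b})" if "t \<in> T'" for t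
          using that by (cases t) simp
        then have "small k (\<Union>(Y, \<alpha>, \<beta>)\<in>T'. {b. gen P \<beta> b})"
          by (rule small_UN[OF \<open>finite T'\<close>])
        then show ?thesis
          using sub by (rule small_subset)
      qed
      \<comment> \<open>A loop returns to the same left word, so its left context is empty and its
        label is a right context \<open>b\<close> with
        \<open>Y \<Rightarrow>\<^sup>* Y b\<close>.\<close>
      have small_loop: "small k {b. gpath (spine P C) W v b v}" if v: "v \<in> W" for v
      proof -
        obtain \<pi>' where "\<forall>b. ctx P (fst v) [] (fst v) b \<longrightarrow> follows b \<pi>'"
          using loops v by (metis W_def mem_Times_iff)
        then show ?thesis
          using gpath_spine_ctx[of P C W v _ v] by (intro small_follows[of _ \<pi>']) force
      qed
      \<comment> \<open>The three factors are the left word at the bottom of the branch, the yield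
        of a right-hand side leaving the component, and the right contexts collected on the
        way.\<close>
      let ?K = "\<Union>v\<in>W. concat_lang {snd v} (concat_lang (leave (fst v)) {b. gpath (spine P C) W (X, []) b v})"
      have "residual u {w. gen P [Nt X] w} \<subseteq> residual u ?K"
      proof
        fix t assume "t \<in> residual u {w. gen P [Nt X] w}"
        then have "gen P [Nt X] (u @ t)"
          by (simp add: residual_def)
        moreover have "X \<in> C"
          by (simp add: C_def reach_refl)
        ultimately have "\<forall>x. \<exists>a Z \<delta> c b. gpath (spine P C) UNIV (X, x) b (Z, x @ a) \<and> Z \<in> C \<and>
           (Z, \<delta>) \<in> P \<and> (\<forall>B\<in>C. Nt B \<notin> set \<delta>) \<and> gen P \<delta> c \<and> u @ t = a @ c @ b"
          using gen_spine_decompose[of P "[Nt X]" "u @ t" "[]" X "[]" C]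
          by (auto elim!: gen_NilE)
        from spec[OF this, of "[]"]
        obtain a Z \<delta> c b where *: "gpath (spine P C) UNIV (X, []) b (Z, a)" "Z \<in> C"
          "(Z, \<delta>) \<in> P" "\<forall>B\<in>C. Nt B \<notin> set \<delta>" "gen P \<delta> c" "u @ t = a @ c @ b"
          by auto
        from gpath_spine_ctx[OF *(1)] have "follows a \<pi>"
          using \<pi> *(2) by auto
        moreover have "length a \<le> length u"
        proof (rule ccontr)
          assume "\<not> length a \<le> length u"
          then have "a = u @ drop (length u) a"
            using *(6) by (metis append_eq_append_conv_if linorder_le_cases append_take_drop_id)
          with \<open>follows a \<pi>\<close> u show False
            by (metis follows_append)
        qed
        ultimately have "(Z, a) \<in> W" "gpath (spine P C) W (X, []) b (Z, a)"
          using gpath_spine_restrict[OF *(1)] *(2) \<open>X \<in> C\<close> unfolding W_def by auto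
        moreover have "c \<in> leave Z"
          using *(3-5) unfolding leave_def by blast
        ultimately show "t \<in> residual u ?K"
          using *(6) unfolding residual_def concat_lang_def by fastforce
      qed
      moreover have "small k (residual u ?K)"
        using finW small_leave small_gpath[OF finW small_edge small_loop]
        by (intro small_residual small_UN small_concat_lang small_singleton) (auto simp: W_def)
      ultimately show ?thesis
        by (rule small_subset[rotated])
    qed
    then show ?thesis
      using small_Suc by blast
  next
    case False
    then have "{w. gen P [Nt X] w} = {}"
      by blast
    then show ?thesis
      using small_empty by metis
  qed
qed

section \<open>The ordinals below \<open>\<omega>\<^sup>\<omega>\<close>\<close>

definition mset_ord :: "nat multiset rel" where
  "mset_ord = {(\<alpha>, \<beta>). \<alpha> \<le> \<beta>}"

lemma Field_mset_ord [simp]: "Field mset_ord = UNIV"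
  by (auto simp: mset_ord_def Field_def)

lemma Well_order_mset_ord: "Well_order mset_ord"
proof -
  have "mset_ord - Id = {(\<alpha>, \<beta>). \<alpha> < \<beta>}"
    by (auto simp: mset_ord_def)
  then have "wf (mset_ord - Id)"
    by (simp add: wf)
  moreover have "Linear_order mset_ord"
    unfolding linear_order_on_def partial_order_on_def preorder_on_def Field_mset_ord
    by (auto simp: mset_ord_def refl_on_def trans_def antisym_def total_on_def)
  ultimately show ?thesis
    by (simp add: well_order_on_def)
qed

lemma underS_mset_ord: "underS mset_ord \<alpha> = {\<beta>. \<beta> < \<alpha>}"
  by (auto simp: underS_def mset_ord_def)

text \<open>Over a linear order the multiset order is decided at the greatest element whose
  multiplicities differ, which is the comparison used in \<open>ord_exp\<close>.\<close>

lemma less_mset_iff_Max: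
  fixes \<alpha> \<beta> :: "'a::linorder multiset"
  shows "\<alpha> < \<beta> \<longleftrightarrow> (\<exists>x. count \<alpha> x < count \<beta> x \<and> (\<forall>y>x. count \<alpha> y = count \<beta> y))"
proof
  assume less: "\<alpha> < \<beta>"
  define D where "D = {x. count \<alpha> x \<noteq> count \<beta> x}"
  have "D \<subseteq> set_mset \<alpha> \<union> set_mset \<beta>"
    by (auto simp: D_def) (metis count_eq_zero_iff)
  then have fin: "finite D"
    by (rule finite_subset) simp
  have "D \<noteq> {}"
    using less multiset_eq_iff[of \<alpha> \<beta>] by (auto simp: D_def)
  then have "Max D \<in> D"
    using fin by (rule Max_in[rotated])
  have max: "count \<alpha> y = count \<beta> y" if "y > Max D" for y
    using that fin by (force simp: D_def dest: Max_ge)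
  have "\<not> count \<beta> (Max D) < count \<alpha> (Max D)"
    using less max unfolding less_multiset\<^sub>H\<^sub>O by force
  then have "count \<alpha> (Max D) < count \<beta> (Max D)"
    using \<open>Max D \<in> D\<close> by (simp add: D_def)
  with max show "\<exists>x. count \<alpha> x < count \<beta> x \<and> (\<forall>y>x. count \<alpha> y = count \<beta> y)"
    by blast
next
  assume "\<exists>x. count \<alpha> x < count \<beta> x \<and> (\<forall>y>x. count \<alpha> y = count \<beta> y)"
  then obtain x where x: "count \<alpha> x < count \<beta> x" "\<forall>y>x. count \<alpha> y = count \<beta> y"
    by blast
  show "\<alpha> < \<beta>"
    unfolding less_multiset\<^sub>H\<^sub>O
  proof (intro conjI allI impI)
    show "\<alpha> \<noteq> \<beta>"
      using x(1) by auto
    fix y assume "count \<beta> y < count \<alpha> y"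
    with x have "y < x"
      by (metis less_asym less_irrefl linorder_less_linear)
    with x(1) show "\<exists>x>y. count \<alpha> x < count \<beta> x"
      by blast
  qed
qed

text \<open>Multisets are Cantor normal forms: \<open>count \<alpha> x\<close> is the coefficient of
  the power of \<omega> with exponent \<open>x\<close>, and the functions of finite support are
  exactly the multiplicity functions.\<close>

lemma ord_exp_omega_omega: "ord_exp omega omega = dir_image mset_ord count"
proof -
  have "underS omega n \<noteq> {} \<longleftrightarrow> n > 0" for n
    by (auto simp: natLeq_underS_less)
  then have support: "finite_support omega omega = range count"
    unfolding finite_support_def Field_natLeq
    by (auto simp: image_iff PiE_UNIV_domain) (metis count_Abs_multiset)
  have less: "(x, y) \<in> omega - Id \<longleftrightarrow> x < y" for x y
    by (auto simp: natLeq_def)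
  have *: "(count \<alpha> = count \<beta> \<or> (\<exists>x\<in>Field omega. (count \<alpha> x, count \<beta> x) \<in> omega - Id \<and>
      (\<forall>y. (x, y) \<in> omega - Id \<longrightarrow> count \<alpha> y = count \<beta> y))) \<longleftrightarrow> (\<alpha>, \<beta>) \<in> mset_ord" for \<alpha> \<beta>
    unfolding mset_ord_def less Field_natLeq
    using less_mset_iff_Max[of \<alpha> \<beta>] by (auto simp: count_inject le_less)
  have "ord_exp omega omega = {(count \<alpha>, count \<beta>) | \<alpha> \<beta>. count \<alpha> = count \<beta> \<or>
      (\<exists>x\<in>Field omega. (count \<alpha> x, count \<beta> x) \<in> omega - Id \<and>
        (\<forall>y. (x, y) \<in> omega - Id \<longrightarrow> count \<alpha> y = count \<beta> y))}"
    unfolding ord_exp_def support by blast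
  then show ?thesis
    unfolding dir_image_def * .
qed

definition mset_code :: "nat multiset \<Rightarrow> nat" where
  "mset_code \<alpha> = to_nat (sorted_list_of_multiset \<alpha>)"

lemma inj_mset_code: "inj mset_code"
  unfolding mset_code_def by (intro injI) (metis from_nat_to_nat mset_sorted_list_of_multiset)

text \<open>The proper initial segment of \<open>mset_ord\<close> at \<alpha>, coded by natural
  numbers because \<open>hausdorff_class\<close> expects a relation on \<open>nat\<close>.\<close>

definition ord_of :: "nat multiset \<Rightarrow> nat rel" where
  "ord_of \<alpha> = dir_image (Restr mset_ord (underS mset_ord \<alpha>)) mset_code"

lemma ordIso_ord_of: "Restr mset_ord (underS mset_ord \<alpha>) =o ord_of \<alpha>"
  unfolding ord_of_def
  by (intro dir_image_ordIso Well_order_Restr Well_order_mset_ord) (meson inj_mset_code inj_on_subset subset_UNIV)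

lemma Well_order_ord_of: "Well_order (ord_of \<alpha>)"
  using ordIso_ord_of unfolding ordIso_def by blast

text \<open>An equality rather than an isomorphism, since \<open>hausdorff_class\<close> tests for
  the empty relation itself.\<close>

lemma ord_of_empty: "ord_of {#} = {}"
  by (auto simp: ord_of_def dir_image_def underS_mset_ord)

lemma ord_of_less:
  assumes "\<alpha> < \<beta>"
  shows "ord_of \<alpha> <o ord_of \<beta>"
proof -
  have "wo_rel.ofilter mset_ord (underS mset_ord \<gamma>)" for \<gamma>
    using Well_order_mset_ord by (simp add: wo_rel_def wo_rel.underS_ofilter)
  moreover have "underS mset_ord \<alpha> \<subset> underS mset_ord \<beta>"
    using assms unfolding underS_mset_ord by auto
  ultimately have "Restr mset_ord (underS mset_ord \<alpha>) <o Restr mset_ord (underS mset_ord \<beta>)"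
    using ofilter_subset_ordLess[OF Well_order_mset_ord] by blast
  then show ?thesis
    using ordIso_ord_of ordIso_symmetric ordIso_ordLess_trans ordLess_ordIso_trans by blast
qed

lemma ord_of_nonempty: "{#} < \<alpha> \<Longrightarrow> ord_of \<alpha> \<noteq> {}"
  using ord_of_less[of "{#}" \<alpha>] ordLess_irreflexive unfolding ord_of_empty by metis

lemma ord_of_less_omega_omega: "ord_of \<alpha> <o ord_exp omega omega"
proof -
  have "Restr mset_ord (underS mset_ord \<alpha>) <o mset_ord"
    by (intro underS_Restr_ordLess Well_order_mset_ord) simp
  moreover have "mset_ord =o ord_exp omega omega"
    unfolding ord_exp_omega_omega
    by (intro dir_image_ordIso Well_order_mset_ord) (auto intro: injI simp: count_inject)
  ultimately show ?thesis
    using ordIso_ord_of ordIso_symmetric ordIso_ordLess_trans ordLess_ordIso_trans by blast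
qed

section \<open>Hausdorff classes of languages\<close>

lemma order_isomorphic_iff:
  "order_isomorphic r s \<longleftrightarrow> (\<exists>f. bij_betw f (Field r) (Field s) \<and>
     (\<forall>a\<in>Field r. \<forall>b\<in>Field r. (a, b) \<in> r \<longleftrightarrow> (f a, f b) \<in> s))"
  unfolding order_isomorphic_def iso_iff2 by blast

lemma order_isomorphic_trans:
  assumes "order_isomorphic r s" "order_isomorphic s t"
  shows "order_isomorphic r t"
proof -
  obtain f g where "bij_betw f (Field r) (Field s)"
    "\<forall>a\<in>Field r. \<forall>b\<in>Field r. (a, b) \<in> r \<longleftrightarrow> (f a, f b) \<in> s"
    "bij_betw g (Field s) (Field t)"
    "\<forall>a\<in>Field s. \<forall>b\<in>Field s. (a, b) \<in> s \<longleftrightarrow> (g a, g b) \<in> t"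
    using assms unfolding order_isomorphic_iff by blast
  then show ?thesis
    unfolding order_isomorphic_iff
    by (intro exI[of _ "g \<circ> f"]) (auto intro: bij_betw_trans simp: bij_betwE)
qed

lemma order_isomorphic_sym:
  assumes "order_isomorphic r s"
  shows "order_isomorphic s r"
proof -
  obtain f where f: "bij_betw f (Field r) (Field s)"
    "\<forall>a\<in>Field r. \<forall>b\<in>Field r. (a, b) \<in> r \<longleftrightarrow> (f a, f b) \<in> s"
    using assms unfolding order_isomorphic_iff by blast
  let ?g = "inv_into (Field r) f"
  have "?g a \<in> Field r \<and> f (?g a) = a" if "a \<in> Field s" for a
    using f(1) that by (auto simp: bij_betw_def inv_into_into f_inv_into_f)
  then have "\<forall>a\<in>Field s. \<forall>b\<in>Field s. (a, b) \<in> s \<longleftrightarrow> (?g a, ?g b) \<in> r"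
    using f(2) by auto
  then show ?thesis
    unfolding order_isomorphic_iff using bij_betw_inv_into[OF f(1)] by blast
qed

lemma order_isomorphic_dir_image:
  assumes "inj_on f (Field r)"
  shows "order_isomorphic r (dir_image r f)"
  unfolding order_isomorphic_iff
proof (intro exI conjI ballI)
  show "bij_betw f (Field r) (Field (dir_image r f))"
    using assms by (simp add: bij_betw_def dir_image_Field)
  fix a b assume ab: "a \<in> Field r" "b \<in> Field r"
  show "(a, b) \<in> r \<longleftrightarrow> (f a, f b) \<in> dir_image r f"
  proof
    assume "(f a, f b) \<in> dir_image r f"
    then obtain c d where cd: "(c, d) \<in> r" "f a = f c" "f b = f d"
      by (auto simp: dir_image_def)
    then have "c \<in> Field r" "d \<in> Field r"
      by (auto intro: FieldI1 FieldI2)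
    with cd ab show "(a, b) \<in> r"
      using assms by (auto dest: inj_onD)
  qed (auto simp: dir_image_def)
qed

text \<open>Strict comparability makes the pieces disjoint, so each word has a unique index and the
  union is their ordered sum. Countability of the index type allows the sum to be copied to the
  natural numbers, where the Hausdorff classes live.\<close>

lemma lex_ordering_UN_isomorphic:
  fixes I :: "'i::countable rel" and q :: "'i \<Rightarrow> nat rel" and K :: "'i \<Rightarrow> 'a::linorder list set"
  assumes total: "Total I"
    and q: "\<And>i. i \<in> Field I \<Longrightarrow> order_isomorphic (lex_ordering (K i)) (q i)"
    and less: "\<And>i j u v. (i, j) \<in> I - Id \<Longrightarrow> u \<in> K i \<Longrightarrow> v \<in> K j \<Longrightarrow> lex_less u v"
  shows "\<exists>p :: nat rel. order_isomorphic (lex_ordering (\<Union>i\<in>Field I. K i)) p \<and>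
    order_isomorphic p (ordered_sum I q)"
proof -
  have "\<forall>i\<in>Field I. \<exists>g. bij_betw g (K i) (Field (q i)) \<and>
      (\<forall>u\<in>K i. \<forall>v\<in>K i. (u, v) \<in> lex_ordering (K i) \<longleftrightarrow> (g u, g v) \<in> q i)"
    using q unfolding order_isomorphic_iff Field_lex_ordering by blast
  from bchoice[OF this] obtain g where g: "\<And>i. i \<in> Field I \<Longrightarrow> bij_betw (g i) (K i) (Field (q i))"
    and g': "\<And>i u v. i \<in> Field I \<Longrightarrow> u \<in> K i \<Longrightarrow> v \<in> K i \<Longrightarrow>
      (u, v) \<in> lex_ordering (K i) \<longleftrightarrow> (g i u, g i v) \<in> q i"
    by blast
  \<comment> \<open>Reflexivity of \<open>q i\<close> is inherited through the isomorphism; it puts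
    every pair into the field of the sum.\<close>
  have refl: "(x, x) \<in> q i" if i: "i \<in> Field I" and x: "x \<in> Field (q i)" for i x
  proof -
    obtain u where "u \<in> K i" "x = g i u"
      using g[OF i] x by (auto simp: bij_betw_def)
    then show ?thesis
      using g'[OF i, of u u] by (simp add: lex_ordering_def)
  qed
  have Field_sum: "Field (ordered_sum I q) = (SIGMA i:Field I. Field (q i))"
  proof
    show "(SIGMA i:Field I. Field (q i)) \<subseteq> Field (ordered_sum I q)"
    proof clarify
      fix i x assume "i \<in> Field I" "x \<in> Field (q i)"
      then have "((i, x), (i, x)) \<in> ordered_sum I q"
        using refl by (simp add: ordered_sum_def)
      then show "(i, x) \<in> Field (ordered_sum I q)"
        by (rule FieldI1)
    qed
  qed (auto simp: ordered_sum_def Field_def)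
  have disj: "i = j" if "i \<in> Field I" "j \<in> Field I" "u \<in> K i" "u \<in> K j" for i j u
    using that less total lex_less_irrefl unfolding total_on_def by blast
  define ix where "ix u = (SOME i. i \<in> Field I \<and> u \<in> K i)" for u
  have ix: "ix u = i" if "i \<in> Field I" "u \<in> K i" for i u
    unfolding ix_def by (rule some_equality) (use that disj in auto)
  define h where "h u = (ix u, g (ix u) u)" for u
  have h: "h u = (i, g i u)" if "i \<in> Field I" "u \<in> K i" for i u
    using ix[OF that] by (simp add: h_def)
  have "bij_betw h (\<Union>i\<in>Field I. K i) (SIGMA i:Field I. Field (q i))"
    unfolding bij_betw_def
  proof
    show "inj_on h (\<Union>i\<in>Field I. K i)"
    proof (rule inj_onI)
      fix u v assume "u \<in> (\<Union>i\<in>Field I. K i)" "v \<in> (\<Union>i\<in>Field I. K i)" and eq: "h u = h v"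
      then obtain i j where *: "i \<in> Field I" "u \<in> K i" "j \<in> Field I" "v \<in> K j"
        by blast
      with eq have "i = j" "g i u = g i v"
        by (auto simp: h)
      then show "u = v"
        using g[OF *(1)] * by (auto simp: bij_betw_def inj_on_def)
    qed
    show "h ` (\<Union>i\<in>Field I. K i) = (SIGMA i:Field I. Field (q i))"
    proof
      show "h ` (\<Union>i\<in>Field I. K i) \<subseteq> (SIGMA i:Field I. Field (q i))"
        by (auto simp: h bij_betw_apply[OF g])
      show "(SIGMA i:Field I. Field (q i)) \<subseteq> h ` (\<Union>i\<in>Field I. K i)"
      proof clarify
        fix i x assume i: "i \<in> Field I" "x \<in> Field (q i)"
        then obtain u where "u \<in> K i" "x = g i u"
          using g by (auto simp: bij_betw_def)
        with i have "(i, x) = h u" "u \<in> (\<Union>i\<in>Field I. K i)"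
          by (auto simp: h)
        then show "(i, x) \<in> h ` (\<Union>i\<in>Field I. K i)"
          by blast
      qed
    qed
  qed
  moreover have "(u, v) \<in> lex_ordering (\<Union>i\<in>Field I. K i) \<longleftrightarrow> (h u, h v) \<in> ordered_sum I q"
    if uv: "u \<in> (\<Union>i\<in>Field I. K i)" "v \<in> (\<Union>i\<in>Field I. K i)" for u v
  proof -
    obtain i j where *: "i \<in> Field I" "u \<in> K i" "j \<in> Field I" "v \<in> K j"
      using uv by blast
    have "(h u, h v) \<in> ordered_sum I q \<longleftrightarrow> (i, j) \<in> I - Id \<or> i = j \<and> (g i u, g i v) \<in> q i"
      using * g[OF *(1)] g[OF *(3)] by (auto simp: h ordered_sum_def bij_betw_def)
    also have "\<dots> \<longleftrightarrow> u = v \<or> lex_less u v"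
    proof (cases "i = j")
      case True
      then show ?thesis
        using g'[of i u v] * by (simp add: lex_ordering_def)
    next
      case False
      then consider "(i, j) \<in> I - Id" | "(j, i) \<in> I - Id"
        using total * unfolding total_on_def by blast
      then show ?thesis
      proof cases
        case 1
        then show ?thesis
          using less * by blast
      next
        case 2
        then have "lex_less v u"
          using less * by blast
        then have "\<not> lex_less u v" "u \<noteq> v"
          using lex_less_asym lex_less_irrefl by blast+
        moreover have "(i, j) \<notin> I - Id"
          using less[of i j u v] * \<open>\<not> lex_less u v\<close> by blast
        ultimately show ?thesis
          using False by blast
      qed
    qed
    finally show ?thesis
      using uv by (simp add: lex_ordering_def)
  qed
  ultimately have iso: "order_isomorphic (lex_ordering (\<Union>i\<in>Field I. K i)) (ordered_sum I q)"
    unfolding order_isomorphic_iff Field_lex_ordering Field_sum by blast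
  have "order_isomorphic (ordered_sum I q) (dir_image (ordered_sum I q) to_nat)"
    by (rule order_isomorphic_dir_image) (auto intro: inj_onI)
  then show ?thesis
    using order_isomorphic_trans[OF iso] order_isomorphic_sym by blast
qed

section \<open>Closure of the Hausdorff classes under sums of languages\<close>

definition hclass :: "nat multiset \<Rightarrow> 'a::linorder list set \<Rightarrow> bool" where
  "hclass \<alpha> L \<longleftrightarrow> in_hausdorff_class (lex_ordering L) (ord_of \<alpha>)"

lemma hclass_empty_iff: "hclass {#} L \<longleftrightarrow> finite L"
proof
  assume "hclass {#} L"
  then obtain p where "p \<in> hausdorff_class {}" "order_isomorphic (lex_ordering L) p"
    unfolding hclass_def in_hausdorff_class_def ord_of_empty by blast
  moreover from this(1) have "finite (Field p)"
    by (subst (asm) hausdorff_class.simps) simp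
  ultimately show "finite L"
    unfolding order_isomorphic_iff Field_lex_ordering using bij_betw_finite by blast
next
  assume L: "finite L"
  then obtain f :: "'a list \<Rightarrow> nat" where f: "inj_on f L"
    using finite_imp_inj_to_nat_seg by blast
  let ?p = "dir_image (lex_ordering L) f"
  have "Linear_order ?p" "finite (Field ?p)" "order_isomorphic (lex_ordering L) ?p"
    using f L Linear_order_dir_image[OF Linear_order_lex_ordering, of f L]
    by (simp_all add: dir_image_Field order_isomorphic_dir_image)
  then show "hclass {#} L"
    unfolding hclass_def in_hausdorff_class_def ord_of_empty
    by (subst hausdorff_class.simps) auto
qed

lemma hclass_UN_int:
  fixes K :: "int \<Rightarrow> 'a::linorder list set"
  assumes K: "\<And>i. hclass \<alpha> (K i)" and "\<alpha> < \<beta>"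
    and less: "\<And>i j u v. i < j \<Longrightarrow> u \<in> K i \<Longrightarrow> v \<in> K j \<Longrightarrow> lex_less u v"
  shows "hclass \<beta> (\<Union>i. K i)"
proof -
  have "\<exists>q. q \<in> hausdorff_class (ord_of \<alpha>) \<and> order_isomorphic (lex_ordering (K i)) q" for i
    using K unfolding hclass_def in_hausdorff_class_def by blast
  then obtain q where q: "\<And>i. q i \<in> hausdorff_class (ord_of \<alpha>)"
    "\<And>i. order_isomorphic (lex_ordering (K i)) (q i)"
    by metis
  have Field: "Field {(i :: int, j). i \<le> j} = UNIV"
    by (auto simp: Field_def)
  have "Total {(i :: int, j). i \<le> j}"
    unfolding total_on_def by auto
  then have "\<exists>p :: nat rel. order_isomorphic (lex_ordering (\<Union>i\<in>Field {(i, j). i \<le> j}. K i)) p \<and>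
      order_isomorphic p (ordered_sum {(i, j). i \<le> j} q)"
    by (rule lex_ordering_UN_isomorphic) (use q(2) less in \<open>auto simp: less_le\<close>)
  then obtain p :: "nat rel" where
    p: "order_isomorphic (lex_ordering (\<Union>i\<in>Field {(i, j). i \<le> j}. K i)) p"
    "order_isomorphic p (ordered_sum {(i, j). i \<le> j} q)"
    by blast
  have "{#} < \<beta>"
    using \<open>\<alpha> < \<beta>\<close> by (metis bot.extremum_strict bot.not_eq_extremum bot_multiset_def)
  then have "p \<in> hausdorff_class (ord_of \<beta>)"
    using ord_of_nonempty[of \<beta>] q(1) p(2) ord_of_less[OF \<open>\<alpha> < \<beta>\<close>]
    by (subst hausdorff_class.simps) (auto intro!: finite_sum_closure.base)
  then show ?thesis
    unfolding hclass_def in_hausdorff_class_def using p(1) unfolding Field by blast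
qed

text \<open>A sum of two terms. The class of rank zero is not defined as a closure under finite sums
  and is settled by finiteness.\<close>

lemma hclass_Un:
  assumes K: "hclass \<alpha> K" and L: "hclass \<alpha> L"
    and less: "\<And>u v. u \<in> K \<Longrightarrow> v \<in> L \<Longrightarrow> lex_less u v"
  shows "hclass \<alpha> (K \<union> L)"
proof (cases "\<alpha> = {#}")
  case True
  then show ?thesis
    using assms by (simp add: hclass_empty_iff)
next
  case False
  then have ne: "ord_of \<alpha> \<noteq> {}"
    by (intro ord_of_nonempty) simp
  obtain p q where pq: "p \<in> hausdorff_class (ord_of \<alpha>)" "order_isomorphic (lex_ordering K) p"
    "q \<in> hausdorff_class (ord_of \<alpha>)" "order_isomorphic (lex_ordering L) q"
    using K L unfolding hclass_def in_hausdorff_class_def by blast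
  define M where "M i = (if i = 0 then K else L)" for i :: nat
  define m where "m i = (if i = 0 then p else q)" for i :: nat
  have "Total (natLeq_on 2)"
    unfolding total_on_def by (auto simp: Field_natLeq_on)
  then have "\<exists>s :: nat rel. order_isomorphic (lex_ordering (\<Union>i\<in>Field (natLeq_on 2). M i)) s \<and>
      order_isomorphic s (ordered_sum (natLeq_on 2) m)"
    by (rule lex_ordering_UN_isomorphic) (use pq less in \<open>auto simp: M_def m_def\<close>)
  then obtain s :: "nat rel" where
    s: "order_isomorphic (lex_ordering (\<Union>i\<in>Field (natLeq_on 2). M i)) s"
    "order_isomorphic s (ordered_sum (natLeq_on 2) m)"
    by blast
  obtain G where G: "hausdorff_class (ord_of \<alpha>) = finite_sum_closure G"
    using hausdorff_class.simps[of "ord_of \<alpha>"] ne by simp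
  have "m i \<in> finite_sum_closure G" for i
    using pq(1,3) by (simp add: m_def G)
  then have "s \<in> hausdorff_class (ord_of \<alpha>)"
    unfolding G using s(2) by (rule finite_sum_closure.finite_sum)
  moreover have "(\<Union>i\<in>Field (natLeq_on 2). M i) = K \<union> L"
  proof -
    have "Field (natLeq_on 2) = {0, 1}"
      unfolding Field_natLeq_on by auto
    then show ?thesis
      by (simp add: M_def Un_commute)
  qed
  ultimately show ?thesis
    unfolding hclass_def in_hausdorff_class_def using s(1) by auto
qed

text \<open>For nonzero \<alpha>, a sum over the integers with at most one nonempty summand.\<close>

lemma hclass_finite:
  assumes "finite L"
  shows "hclass \<alpha> L"
proof (cases "\<alpha> = {#}")
  case False
  have "hclass \<alpha> (\<Union>i. if i = (0 :: int) then L else {})"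
    using assms False
    by (intro hclass_UN_int[of "{#}"]) (auto simp: hclass_empty_iff split: if_splits)
  moreover have "(\<Union>i. if i = (0 :: int) then L else {}) = L"
    by auto
  ultimately show ?thesis
    by simp
qed (use assms in \<open>simp add: hclass_empty_iff\<close>)

lemma hclass_UN_increasing:
  fixes K :: "nat \<Rightarrow> 'a::linorder list set"
  assumes "\<And>i. hclass \<alpha> (K i)" "\<alpha> < \<beta>"
    and "\<And>i j u v. i < j \<Longrightarrow> u \<in> K i \<Longrightarrow> v \<in> K j \<Longrightarrow> lex_less u v"
  shows "hclass \<beta> (\<Union>i. K i)"
proof -
  have "hclass \<beta> (\<Union>i. if 0 \<le> i then K (nat i) else {})"
  proof (rule hclass_UN_int[OF _ assms(2)])
    show "hclass \<alpha> (if 0 \<le> i then K (nat i) else {})" for i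
      using assms(1) by (simp add: hclass_finite)
    fix i j u v
    assume "i < j" "u \<in> (if 0 \<le> i then K (nat i) else {})"
      "v \<in> (if 0 \<le> j then K (nat j) else {})"
    then show "lex_less u v"
      using assms(3)[of "nat i" "nat j" u v] by (auto split: if_splits)
  qed
  moreover have "(\<Union>i. if 0 \<le> i then K (nat i) else {}) = (\<Union>i. K i)"
  proof
    show "(\<Union>i. K i) \<subseteq> (\<Union>i. if 0 \<le> i then K (nat i) else {})"
    proof clarify
      fix w i assume "w \<in> K i"
      then have "w \<in> (if 0 \<le> int i then K (nat (int i)) else {})"
        by simp
      then show "w \<in> (\<Union>i. if 0 \<le> i then K (nat i) else {})"
        by blast
    qed
  qed (auto split: if_splits)
  ultimately show ?thesis
    by simp
qed

text \<open>Placing index \<open>i\<close> at the integer \<open>- i\<close> reverses the sum;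
  positive integers carry empty summands.\<close>

lemma hclass_UN_decreasing:
  fixes K :: "nat \<Rightarrow> 'a::linorder list set"
  assumes "\<And>i. hclass \<alpha> (K i)" "\<alpha> < \<beta>"
    and "\<And>i j u v. i < j \<Longrightarrow> u \<in> K j \<Longrightarrow> v \<in> K i \<Longrightarrow> lex_less u v"
  shows "hclass \<beta> (\<Union>i. K i)"
proof -
  have "hclass \<beta> (\<Union>i. if i \<le> 0 then K (nat (- i)) else {})"
  proof (rule hclass_UN_int[OF _ assms(2)])
    show "hclass \<alpha> (if i \<le> 0 then K (nat (- i)) else {})" for i
      using assms(1) by (simp add: hclass_finite)
    fix i j u v
    assume "i < j" "u \<in> (if i \<le> 0 then K (nat (- i)) else {})"
      "v \<in> (if j \<le> 0 then K (nat (- j)) else {})"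
    then show "lex_less u v"
      using assms(3)[of "nat (- j)" "nat (- i)" u v] by (auto split: if_splits)
  qed
  moreover have "(\<Union>i. if i \<le> 0 then K (nat (- i)) else {}) = (\<Union>i. K i)"
  proof
    show "(\<Union>i. K i) \<subseteq> (\<Union>i. if i \<le> 0 then K (nat (- i)) else {})"
    proof clarify
      fix w i assume "w \<in> K i"
      then have "w \<in> (if - int i \<le> 0 then K (nat (- (- int i))) else {})"
        by simp
      then show "w \<in> (\<Union>i. if i \<le> 0 then K (nat (- i)) else {})"
        by blast
    qed
  qed (auto split: if_splits)
  ultimately show ?thesis
    by simp
qed

lemma hclass_UN_finite:
  fixes A :: "'b::linorder set"
  assumes "finite A" "\<And>a. a \<in> A \<Longrightarrow> hclass \<alpha> (K a)"
    and "\<And>a b u v. a < b \<Longrightarrow> u \<in> K a \<Longrightarrow> v \<in> K b \<Longrightarrow> lex_less u v"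
  shows "hclass \<alpha> (\<Union>a\<in>A. K a)"
  using assms(1,2)
proof (induction A rule: finite_linorder_max_induct)
  case empty
  then show ?case
    by (simp add: hclass_finite)
next
  case (insert b A)
  then have "hclass \<alpha> ((\<Union>a\<in>A. K a) \<union> K b)"
    using assms(3) by (intro hclass_Un) auto
  then show ?case
    by (simp add: Un_commute)
qed

lemma hclass_append:
  assumes "hclass \<alpha> L"
  shows "hclass \<alpha> ((@) u ` L)"
proof -
  have "lex_ordering ((@) u ` L) = dir_image (lex_ordering L) ((@) u)"
    unfolding lex_ordering_def dir_image_def by (auto intro: lexord_append_leftI dest!: lexord_append_leftD)
  then have "order_isomorphic (lex_ordering L) (lex_ordering ((@) u ` L))"
    by (simp add: order_isomorphic_dir_image inj_on_def)
  then show ?thesis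
    using assms order_isomorphic_trans order_isomorphic_sym
    unfolding hclass_def in_hausdorff_class_def by blast
qed

section \<open>Cutting a language along finite and infinite words\<close>

lemma lex_less_append: "lex_less u (u @ a # r)"
  by (rule lexord_append_rightI) simp

lemma lex_less_branch: "a < b \<Longrightarrow> lex_less (u @ a # r) (u @ b # s)"
  by (rule lexord_append_left_rightI) simp

lemma residual_subset_lists: "L \<subseteq> lists \<Sigma> \<Longrightarrow> residual u L \<subseteq> lists \<Sigma>"
  by (auto simp: residual_def)

lemma hclass_residual_Cons:
  assumes "hclass \<alpha> (residual (u @ [b]) L)"
  shows "hclass \<alpha> {w \<in> L. \<exists>r. w = u @ b # r}"
proof -
  have "{w \<in> L. \<exists>r. w = u @ b # r} = (@) (u @ [b]) ` residual (u @ [b]) L"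
    by (auto simp: residual_def image_iff)
  then show ?thesis
    using hclass_append[OF assms] by (simp only:)
qed

text \<open>A language is the finite ordered sum of its part in \<open>{[]}\<close> and its parts
  with a given first letter, and finite sums do not raise the class. This is repeated for
  \<open>n\<close> letters.\<close>

lemma hclass_if_residual:
  assumes "finite \<Sigma>" "L \<subseteq> lists \<Sigma>"
    and "\<And>u. length u = n \<Longrightarrow> hclass \<alpha> (residual u L)"
  shows "hclass \<alpha> L"
  using assms(3)
proof (induction n)
  case 0
  then show ?case
    using "0"[of "[]"] by (simp add: residual_def)
next
  case (Suc n)
  show ?case
  proof (rule Suc.IH)
    fix u :: "'a list" assume u: "length u = n"
    let ?K = "residual u L"
    have "hclass \<alpha> (?K \<inter> {[]} \<union> (\<Union>a\<in>\<Sigma>. {w \<in> ?K. \<exists>r. w = [] @ a # r}))"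
    proof (intro hclass_Un hclass_UN_finite hclass_residual_Cons assms(1))
      show "hclass \<alpha> (residual ([] @ [a]) ?K)" for a
        using Suc.prems[of "u @ [a]"] u by (simp add: residual_append)
    qed (auto simp: hclass_finite intro: lex_less_append[of "[]", simplified] lex_less_branch[of _ _ "[]", simplified])
    moreover have "?K \<inter> {[]} \<union> (\<Union>a\<in>\<Sigma>. {w \<in> ?K. \<exists>r. w = [] @ a # r}) = ?K"
    proof
      show "?K \<subseteq> ?K \<inter> {[]} \<union> (\<Union>a\<in>\<Sigma>. {w \<in> ?K. \<exists>r. w = [] @ a # r})"
      proof
        fix w assume "w \<in> ?K"
        then show "w \<in> ?K \<inter> {[]} \<union> (\<Union>a\<in>\<Sigma>. {w \<in> ?K. \<exists>r. w = [] @ a # r})"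
          using residual_subset_lists[OF assms(2), of u] by (cases w) auto
      qed
    qed auto
    ultimately show "hclass \<alpha> ?K"
      by simp
  qed
qed

text \<open>The words branching off the path to the left form an \<open>\<omega>\<close>-sum together with the words on the
  path, and the words branching off to the right form a reversed \<open>\<omega>\<close>-sum.\<close>

lemma hclass_if_path:
  fixes L :: "'a::linorder list set"
  assumes fin: "finite \<Sigma>" and L: "L \<subseteq> lists \<Sigma>" and less: "\<alpha> < \<beta>"
    and off: "\<And>u. \<not> follows u \<pi> \<Longrightarrow> hclass \<alpha> (residual u L)"
  shows "hclass \<beta> L"
proof -
  define pre where "pre n = map \<pi> [0..<n]" for n
  have pre_add: "\<exists>r. pre n = pre m @ \<pi> m # r" if "m < n" for m n
  proof -
    have "[0..<n] = [0..<m] @ m # [Suc m..<n]"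
      using that upt_add_eq_append[of 0 m "n - m"] by (simp add: upt_conv_Cons)
    then show ?thesis
      by (simp add: pre_def)
  qed
  define branch where "branch n b = {w \<in> L. \<exists>r. w = pre n @ b # r}" for n b
  define left where "left n = L \<inter> {pre n} \<union> (\<Union>b\<in>{b\<in>\<Sigma>. b < \<pi> n}. branch n b)" for n
  define right where "right n = (\<Union>b\<in>{b\<in>\<Sigma>. \<pi> n < b}. branch n b)" for n
  have branch: "hclass \<alpha> (branch n b)" if "b \<noteq> \<pi> n" for n b
    unfolding branch_def
  proof (intro hclass_residual_Cons off)
    show "\<not> follows (pre n @ [b]) \<pi>"
      using that by (simp add: follows_append follows_def[of "[b]"] pre_def)
  qed
  have left: "hclass \<alpha> (left n)" for n
    unfolding left_def using fin
    by (intro hclass_Un hclass_UN_finite branch hclass_finite)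
      (auto simp: branch_def intro: lex_less_append lex_less_branch)
  have right: "hclass \<alpha> (right n)" for n
    unfolding right_def using fin
    by (intro hclass_UN_finite branch) (auto simp: branch_def intro: lex_less_branch)
  \<comment> \<open>Words of pieces with index above \<open>m\<close> continue along \<pi> past
    position \<open>m\<close>, so pieces of different index are compared at the smaller
    index.\<close>
  have leftE: "\<exists>r. w = pre m @ \<pi> m # r" if "w \<in> left n" "m < n" for w m n
    using that pre_add[OF that(2)] by (auto simp: left_def branch_def)
  have rightE: "\<exists>r. w = pre m @ \<pi> m # r" if "w \<in> right n" "m < n" for w m n
    using that pre_add[OF that(2)] by (auto simp: right_def branch_def)
  have left_less: "lex_less u (pre n @ \<pi> n # r)" if "u \<in> left n" for u n r
    using that by (auto simp: left_def branch_def intro: lex_less_append lex_less_branch)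
  have right_less: "lex_less (pre n @ \<pi> n # r) u" if "u \<in> right n" for u n r
    using that by (auto simp: right_def branch_def intro: lex_less_branch)
  have "hclass \<beta> ((\<Union>n. left n) \<union> (\<Union>n. right n))"
  proof (intro hclass_Un)
    show "hclass \<beta> (\<Union>n. left n)"
    proof (rule hclass_UN_increasing[OF left less])
      show "lex_less u v" if "i < j" "u \<in> left i" "v \<in> left j" for i j u v
        using leftE[OF that(3,1)] left_less[OF that(2)] by blast
    qed
    show "hclass \<beta> (\<Union>n. right n)"
    proof (rule hclass_UN_decreasing[OF right less])
      show "lex_less u v" if "i < j" "u \<in> right j" "v \<in> right i" for i j u v
        using rightE[OF that(2,1)] right_less[OF that(3)] by blast
    qed
    show "lex_less u v" if uv: "u \<in> (\<Union>n. left n)" "v \<in> (\<Union>n. right n)" for u v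
    proof -
      obtain i j where ij: "u \<in> left i" "v \<in> right j"
        using uv by blast
      consider "i < j" | "j < i" | "i = j"
        by linarith
      then show ?thesis
      proof cases
        case 1
        then show ?thesis
          using rightE[OF ij(2)] left_less[OF ij(1)] by blast
      next
        case 2
        then show ?thesis
          using leftE[OF ij(1)] right_less[OF ij(2)] by blast
      next
        case 3
        then show ?thesis
          using left_less[OF ij(1), of "[]"] right_less[OF ij(2), of "[]"] lex_less_trans by blast
      qed
    qed
  qed
  moreover have "L = (\<Union>n. left n) \<union> (\<Union>n. right n)"
  proof
    show "L \<subseteq> (\<Union>n. left n) \<union> (\<Union>n. right n)"
    proof
      fix w assume w: "w \<in> L"
      show "w \<in> (\<Union>n. left n) \<union> (\<Union>n. right n)"
      proof (cases "follows w \<pi>")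
        case True
        then have "w = pre (length w)"
          unfolding pre_def by (intro nth_equalityI) (simp_all add: follows_def)
        then have "w \<in> left (length w)"
          using w by (simp add: left_def)
        then show ?thesis
          by blast
      next
        case False
        then have ex: "\<exists>i. i < length w \<and> w ! i \<noteq> \<pi> i"
          by (simp add: follows_def)
        define i where "i = (LEAST i. i < length w \<and> w ! i \<noteq> \<pi> i)"
        have i: "i < length w" "w ! i \<noteq> \<pi> i"
          using LeastI_ex[OF ex] by (simp_all add: i_def)
        have "w ! j = \<pi> j" if "j < i" for j
          using not_less_Least[of j "\<lambda>i. i < length w \<and> w ! i \<noteq> \<pi> i"] that i(1) by (auto simp: i_def)
        then have "take i w = pre i"
          unfolding pre_def using i(1) by (intro nth_equalityI) auto
        then have "w = pre i @ w ! i # drop (Suc i) w"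
          using id_take_nth_drop[OF i(1)] by simp
        then have "w \<in> branch i (w ! i)"
          using w by (auto simp: branch_def)
        moreover have "w ! i \<in> \<Sigma>"
          using L w i(1) by (auto simp: in_lists_conv_set)
        ultimately have "w \<in> left i \<or> w \<in> right i"
          using i(2) linorder_neqE[of "w ! i" "\<pi> i"] unfolding left_def right_def by blast
        then show ?thesis
          by blast
      qed
    qed
  qed (auto simp: left_def right_def branch_def)
  ultimately show ?thesis
    by simp
qed

text \<open>For each pair of distinct words some position of difference is chosen; \<open>n\<close>
  exceeds all these positions.\<close>

lemma separate_paths:
  assumes "finite \<Theta>"
  obtains n where "\<And>u \<pi> \<rho>. length u = n \<Longrightarrow> \<pi> \<in> \<Theta> \<Longrightarrow> \<rho> \<in> \<Theta> \<Longrightarrow> follows u \<pi> \<Longrightarrow> follows u \<rho> \<Longrightarrow> \<pi> = \<rho>"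
proof -
  define d where "d \<pi> \<rho> = (SOME i. \<pi> i \<noteq> \<rho> i)" for \<pi> \<rho> :: "nat \<Rightarrow> 'a"
  have d: "\<pi> (d \<pi> \<rho>) \<noteq> \<rho> (d \<pi> \<rho>)" if "\<pi> \<noteq> \<rho>" for \<pi> \<rho> :: "nat \<Rightarrow> 'a"
    unfolding d_def by (rule someI_ex) (use that in auto)
  have "finite ((\<lambda>(\<pi>, \<rho>). d \<pi> \<rho>) ` (\<Theta> \<times> \<Theta>))"
    using assms by simp
  then obtain n where n: "\<And>\<pi> \<rho>. \<pi> \<in> \<Theta> \<Longrightarrow> \<rho> \<in> \<Theta> \<Longrightarrow> d \<pi> \<rho> < n"
    unfolding finite_nat_set_iff_bounded by fastforce
  show ?thesis
  proof (rule that)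
    fix u \<pi> \<rho> assume *: "length u = n" "\<pi> \<in> \<Theta>" "\<rho> \<in> \<Theta>" "follows u \<pi>" "follows u \<rho>"
    show "\<pi> = \<rho>"
    proof (rule ccontr)
      assume "\<pi> \<noteq> \<rho>"
      then show False
        using d n[OF *(2,3)] * by (metis follows_def)
    qed
  qed
qed

text \<open>After \<open>n\<close> letters at most one exceptional word is still followed, so
  \<open>hclass_if_path\<close> handles each residual, and \<open>hclass_if_residual\<close>
  assembles them without raising the class.\<close>

lemma cb_rank_le_imp_hclass:
  fixes L :: "'a::linorder list set"
  assumes "cb_rank_le \<alpha> L" "finite \<Sigma>" "L \<subseteq> lists \<Sigma>" "\<alpha> < \<beta>"
  shows "hclass \<beta> L"
  using assms
proof (induction arbitrary: \<beta> rule: cb_rank_le.induct)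
  case (1 \<Theta> L \<alpha>)
  \<comment> \<open>The residual has a bound strictly below \<alpha>, so the induction hypothesis is
    available with \<alpha> itself as the class.\<close>
  have off: "hclass \<alpha> (residual u L)" if "off \<Theta> u" for u
    using 1(2)[OF that] 1(3) residual_subset_lists[OF 1(4)] by (auto simp: hclass_finite)
  obtain n where n: "\<And>u \<pi> \<rho>. length u = n \<Longrightarrow> \<pi> \<in> \<Theta> \<Longrightarrow> \<rho> \<in> \<Theta> \<Longrightarrow> follows u \<pi> \<Longrightarrow> follows u \<rho> \<Longrightarrow> \<pi> = \<rho>"
    using separate_paths[OF 1(1)] by metis
  show ?case
  proof (rule hclass_if_residual[OF 1(3,4)])
    fix u :: "'a list" assume u: "length u = n"
    \<comment> \<open>If \<open>u\<close> follows no word of \<Theta>, any \<pi> will do.\<close>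
    obtain \<pi> where \<pi>: "\<And>\<rho>. \<rho> \<in> \<Theta> \<Longrightarrow> follows u \<rho> \<Longrightarrow> \<rho> = \<pi>"
      using n[OF u] by metis
    show "hclass \<beta> (residual u L)"
    proof (rule hclass_if_path[OF 1(3) residual_subset_lists[OF 1(4)] 1(5)])
      fix v assume v: "\<not> follows v (\<lambda>i. \<pi> (length u + i))"
      have "off \<Theta> (u @ v)"
        unfolding off_def follows_append using v \<pi> by blast
      then show "hclass \<alpha> (residual v (residual u L))"
        unfolding residual_append[symmetric] by (rule off)
    qed
  qed
qed

text \<open>Well-foundedness of \<open><o\<close> yields a least suitable well-order, so the choice
  in \<open>hausdorff_rank\<close> is not vacuous.\<close>

lemma hausdorff_rank_ordLeq:
  assumes "Well_order \<alpha>" "in_hausdorff_class r \<alpha>"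
  shows "hausdorff_rank r \<le>o \<alpha>"
proof -
  let ?Q = "{\<alpha>. Well_order \<alpha> \<and> in_hausdorff_class r \<alpha>}"
  obtain \<mu> where \<mu>: "\<mu> \<in> ?Q" "\<And>\<beta>. \<beta> <o \<mu> \<Longrightarrow> \<beta> \<notin> ?Q"
    using wfE_min[OF wf_ordLess, of \<alpha> ?Q] assms by blast
  have "Well_order \<mu> \<and> in_hausdorff_class r \<mu> \<and>
      (\<forall>\<beta>. Well_order \<beta> \<and> in_hausdorff_class r \<beta> \<longrightarrow> \<mu> \<le>o \<beta>)"
    using \<mu> ordLess_or_ordLeq by blast
  from someI[where P = "\<lambda>\<alpha>. Well_order \<alpha> \<and> in_hausdorff_class r \<alpha> \<and>
      (\<forall>\<beta>. Well_order \<beta> \<and> in_hausdorff_class r \<beta> \<longrightarrow> \<alpha> \<le>o \<beta>)", OF this]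
  show ?thesis
    unfolding hausdorff_rank_def using assms by blast
qed

theorem theorem12:
  fixes \<Sigma> :: "'a::linorder set" and L :: "'a list set"
  assumes "finite \<Sigma>"
    and "L \<subseteq> lists \<Sigma>"
    and "context_free \<Sigma> L"
    and "scattered (lex_ordering L)"
  shows "hausdorff_rank (lex_ordering L) <o ord_exp omega omega"
proof -
  obtain P and S :: nat where P: "finite P" and L: "L = {w. gen P [Nt S] w}"
    using assms(3) by (auto simp: context_free_def context_free_grammar_def generated_language_eq)
  obtain k where "small k L"
    using small_if_scattered[OF P _ reach_refl] assms(4) unfolding L by blast
  then obtain \<alpha> where "cb_rank_le \<alpha> L"
    by (auto simp: small_def)
  \<comment> \<open>Adding \<open>{#0#}\<close> forms the ordinal successor: the class has to lie
    strictly above the Cantor--Bendixson bound.\<close>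
  then have "hclass (\<alpha> + {#0#}) L"
    using assms(1,2) by (rule cb_rank_le_imp_hclass) simp
  then have "hausdorff_rank (lex_ordering L) \<le>o ord_of (\<alpha> + {#0#})"
    unfolding hclass_def by (rule hausdorff_rank_ordLeq[OF Well_order_ord_of])
  also have "ord_of (\<alpha> + {#0#}) <o ord_exp omega omega"
    by (rule ord_of_less_omega_omega)
  finally show ?thesis .
qed

end
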